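(* Let $B$ be a unital Banach algebra, $F$ a uniformly hyperfinite C*-algebra, and $A=B\hat{\otimes}F$. For each closed Lie ideal $L$ of $A$ there are a closed (two-sided) ideal $I$ of $B$ and a closed Lie ideal $M$ of $B$ such that $L=I\hat{\otimes}F_\tau+M\hat{\otimes}1$.
   Context: $\hat{\otimes}$ is the projective tensor product, and $A$ is a Banach algebra with the product $(b\otimes x)(b'\otimes x')=bb'\otimes xx'$. A C*-algebra $F$ is uniformly hyperfinite (UHF) if it is unital and is the closure of the union of an increasing sequence of C*-subalgebras $F_n$, containing the unit of $F$ and isomorphic to full matrix algebras. Such $F$ has a unique normalized trace $\tau$, and $F_\tau=\ker\tau$. A Lie ideal of an algebra $A$ is a linear subspace $L$ with $ax-xa\in L$ for all $a\in A$, $x\in L$. For closed subspaces $I\subset B$ and $G\subset F$, $I\hat{\otimes}G$ is understood as the closed linear span in $A$ of the elements $b\otimes x$ with $b\in I$, $x\in G$; $M\hat{\otimes}1=\{m\otimes1:m\in M\}$. *)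

theory Defs
  imports "HOL-Analysis.Analysis" "Jordan_Normal_Form.Matrix"
begin

section \<open>Complex Banach algebras and C*-algebras\<close>

text \<open>
  The distribution only has real normed spaces and algebras. A complex one is a real one with a
  complex scalar multiplication that extends the real one.
\<close>

class scaleC =
  fixes scaleC :: "complex \<Rightarrow> 'a \<Rightarrow> 'a"  (infixr \<open>*\<^sub>C\<close> 75)

class complex_vector = real_vector + scaleC +
  assumes scaleC_add_right: "c *\<^sub>C (x + y) = c *\<^sub>C x + c *\<^sub>C y"
    and scaleC_add_left: "(c + d) *\<^sub>C x = c *\<^sub>C x + d *\<^sub>C x"
    and scaleC_scaleC: "c *\<^sub>C (d *\<^sub>C x) = (c * d) *\<^sub>C x"
    and scaleC_of_real: "complex_of_real r *\<^sub>C x = r *\<^sub>R x"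

class complex_banach_algebra = complex_vector + real_normed_algebra + banach +
  assumes norm_scaleC: "norm (c *\<^sub>C x) = cmod c * norm x"
    and mult_scaleC_left: "(c *\<^sub>C x) * y = c *\<^sub>C (x * y)"
    and mult_scaleC_right: "x * (c *\<^sub>C y) = c *\<^sub>C (x * y)"

text \<open>
  Only the existence of a unit is required. Neither \<open>norm 1 = 1\<close> nor \<open>1 \<noteq> 0\<close> is imposed.
\<close>

class unital_complex_banach_algebra = complex_banach_algebra + monoid_mult

class cstar_algebra = complex_banach_algebra +
  fixes star :: "'a \<Rightarrow> 'a"
  assumes star_add: "star (x + y) = star x + star y"
    and star_scaleC: "star (c *\<^sub>C x) = cnj c *\<^sub>C star x"
    and star_mult: "star (x * y) = star y * star x"
    and star_star: "star (star x) = x"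
    and cstar_identity: "norm (star x * x) = (norm x)\<^sup>2"

class unital_cstar_algebra = cstar_algebra + unital_complex_banach_algebra

global_interpretation complex_vector: vector_space "scaleC :: complex \<Rightarrow> 'a \<Rightarrow> 'a::complex_vector"
  defines csubspace = complex_vector.subspace
    and cspan = complex_vector.span
    and cdependent = complex_vector.dependent
proof
  show "1 *\<^sub>C x = x" for x :: 'a
    using scaleC_of_real[of 1 x] by simp
qed (simp_all add: scaleC_add_right scaleC_add_left scaleC_scaleC)

section \<open>Closed ideals and closed Lie ideals\<close>

definition closed_ideal :: "'a::complex_banach_algebra set \<Rightarrow> bool" where
  "closed_ideal I \<longleftrightarrow> csubspace I \<and> closed I \<and> (\<forall>a. \<forall>x\<in>I. a * x \<in> I \<and> x * a \<in> I)"

definition closed_lie_ideal :: "'a::complex_banach_algebra set \<Rightarrow> bool" where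
  "closed_lie_ideal L \<longleftrightarrow> csubspace L \<and> closed L \<and> (\<forall>a. \<forall>x\<in>L. a * x - x * a \<in> L)"

section \<open>Uniformly hyperfinite C*-algebras\<close>

definition cstar_subalgebra :: "'a::cstar_algebra set \<Rightarrow> bool" where
  "cstar_subalgebra S \<longleftrightarrow> csubspace S \<and> closed S \<and>
     (\<forall>x\<in>S. \<forall>y\<in>S. x * y \<in> S) \<and> (\<forall>x\<in>S. star x \<in> S)"

definition isomorphic_to_full_matrix_algebra :: "'a::cstar_algebra set \<Rightarrow> nat \<Rightarrow> bool" where
  "isomorphic_to_full_matrix_algebra S k \<longleftrightarrow>
     (\<exists>\<phi> :: 'a \<Rightarrow> complex mat. bij_betw \<phi> S (carrier_mat k k) \<and>
       (\<forall>x\<in>S. \<forall>y\<in>S. \<phi> (x + y) = \<phi> x + \<phi> y \<and> \<phi> (x * y) = \<phi> x * \<phi> y) \<and>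
       (\<forall>x\<in>S. \<forall>c. \<phi> (c *\<^sub>C x) = c \<cdot>\<^sub>m \<phi> x) \<and>
       (\<forall>x\<in>S. \<phi> (star x) = map_mat cnj (transpose_mat (\<phi> x))))"

definition uhf_algebra :: "'f::unital_cstar_algebra itself \<Rightarrow> bool" where
  "uhf_algebra _ \<longleftrightarrow>
     (\<exists>Fn :: nat \<Rightarrow> 'f set. incseq Fn \<and>
       (\<forall>n. cstar_subalgebra (Fn n) \<and> 1 \<in> Fn n \<and>
            (\<exists>k\<ge>1. isomorphic_to_full_matrix_algebra (Fn n) k)) \<and>
       closure (\<Union>n. Fn n) = UNIV)"

text \<open>A normalized trace is a tracial state.\<close>

definition normalized_trace :: "('f::unital_cstar_algebra \<Rightarrow> complex) \<Rightarrow> bool" where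
  "normalized_trace \<tau> \<longleftrightarrow>
     bounded_linear \<tau> \<and> (\<forall>c x. \<tau> (c *\<^sub>C x) = c * \<tau> x) \<and>
     (\<forall>x. \<tau> (star x * x) \<in> \<real> \<and> Re (\<tau> (star x * x)) \<ge> 0) \<and>
     (\<forall>x y. \<tau> (x * y) = \<tau> (y * x)) \<and> \<tau> 1 = 1"

text \<open>Meaningful only for algebras with exactly one normalized trace, such as UHF algebras.\<close>

definition the_trace :: "'f::unital_cstar_algebra \<Rightarrow> complex" where
  "the_trace = (THE \<tau>. normalized_trace \<tau>)"

definition trace_kernel :: "'f::unital_cstar_algebra set" where
  "trace_kernel = {x. the_trace x = 0}"

section \<open>The projective tensor product\<close>

text \<open>
  The completed tensor product is described up to isometric isomorphism: a Banach algebra \<open>'a\<close>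
  together with a map \<open>t b x = b \<otimes> x\<close>. Bilinearity and \<open>tensor_faithful\<close> say that the linear span of the
  elementary tensors is the algebraic tensor product (\<open>tensor_faithful\<close> is the injectivity of
  the linear map from the algebraic tensor product to \<open>'a\<close>, as each element of the former
  is a finite sum of \<open>f x \<otimes> x\<close> over linearly independent \<open>x\<close>, and vanishes only if all \<open>f x\<close> do).
  \<open>norm_projective\<close> and \<open>tensor_dense\<close>
  say that \<open>'a\<close> is its completion in the projective norm.
\<close>

locale projective_tensor_product =
  fixes t :: "'b::complex_banach_algebra \<Rightarrow> 'f::complex_banach_algebra \<Rightarrow> 'a::complex_banach_algebra"
  assumes tensor_add: "t (b + b') x = t b x + t b' x" "t b (x + x') = t b x + t b x'"
    and tensor_scaleC: "t (c *\<^sub>C b) x = c *\<^sub>C t b x" "t b (c *\<^sub>C x) = c *\<^sub>C t b x"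
    and tensor_faithful:
      "\<lbrakk>finite S; \<not> cdependent S; (\<Sum>x\<in>S. t (f x) x) = 0; x \<in> S\<rbrakk> \<Longrightarrow> f x = 0"
    and norm_projective: "u \<in> cspan {t b x | b x. True} \<Longrightarrow>
      norm u = Inf {(\<Sum>(b, x)\<leftarrow>ps. norm b * norm x) | ps. u = (\<Sum>(b, x)\<leftarrow>ps. t b x)}"
    and tensor_dense: "closure (cspan {t b x | b x. True}) = UNIV"
    and tensor_mult: "t b x * t b' x' = t (b * b') (x * x')"

definition closed_tensor_span ::
    "('b \<Rightarrow> 'f \<Rightarrow> 'a::complex_banach_algebra) \<Rightarrow> 'b set \<Rightarrow> 'f set \<Rightarrow> 'a set" where
  "closed_tensor_span t I G = closure (cspan {t b x | b x. b \<in> I \<and> x \<in> G})"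

end

theory Submission
  imports Defs
begin

text \<open>
  Let \<open>F\<^sub>n\<close> be the matrix subalgebras and \<open>E\<^sub>n a = (1/k) \<Sum> e\<^sub>i\<^sub>j a e\<^sub>j\<^sub>i\<close>. These averages over unitaries are uniformly
  bounded, so on \<open>F\<close> they converge to \<open>\<tau>(x) 1\<close>, and on \<open>A\<close> to \<open>\<Phi>(a) \<otimes> 1\<close>, where \<open>\<Phi> = id \<otimes> \<tau>\<close> is the slice map.
  As \<open>E\<^sub>n\<close> is a combination of iterated commutators, it preserves the Lie ideal \<open>L\<close>; hence \<open>a \<in> L\<close> implies
  \<open>\<Phi>(a) \<otimes> 1 \<in> L\<close>. In the same way \<open>\<Phi>(a x) \<otimes> y \<in> L\<close> for traceless \<open>x\<close> and \<open>y\<close>. So take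
  \<open>I = {b. b \<otimes> F\<^sub>\<tau> \<subseteq> L}\<close> and \<open>M = {m. m \<otimes> 1 \<in> L}\<close>. The trace preserving projections \<open>Q\<^sub>n\<close> of \<open>F\<close> onto \<open>F\<^sub>n\<close> are
  contractive, so \<open>id \<otimes> Q\<^sub>n\<close> converges to the identity of \<open>A\<close> pointwise. For \<open>a \<in> L\<close> the element
  \<open>(id \<otimes> Q\<^sub>n) a - \<Phi>(a) \<otimes> 1\<close> is a finite sum of tensors in \<open>I \<otimes> F\<^sub>\<tau>\<close>, and the decomposition of \<open>a\<close> follows in
  the limit.
\<close>

section \<open>Limits of uniformly bounded operators\<close>

lemma sum_scaleC_right: "c *\<^sub>C (\<Sum>i\<in>A. f i) = (\<Sum>i\<in>A. c *\<^sub>C (f i :: 'a::complex_vector))"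
  by (rule complex_vector.scale_sum_right)

lemma scaleC_double: "2 *\<^sub>C x = x + (x :: 'a::complex_vector)"
  using scaleC_add_left[of 1 1 x] by simp

lemma scaleC_scaleR: "c *\<^sub>C (r *\<^sub>R x) = r *\<^sub>R (c *\<^sub>C (x :: 'a::complex_vector))"
  by (simp add: scaleC_of_real[symmetric] scaleC_scaleC mult.commute)

lemma bounded_linear_scaleC: "bounded_linear (\<lambda>x :: 'a::complex_banach_algebra. c *\<^sub>C x)"
  by (rule bounded_linear_intro[of _ "cmod c"])
    (simp_all add: scaleC_add_right scaleC_scaleR norm_scaleC mult.commute)

lemma bounded_linear_scaleC_left: "bounded_linear (\<lambda>c. c *\<^sub>C (x :: 'a::complex_banach_algebra))"
proof (rule bounded_linear_intro[of _ "norm x"])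
  show "(r *\<^sub>R c) *\<^sub>C x = r *\<^sub>R (c *\<^sub>C x)" for r c
    by (simp only: scaleR_conv_of_real scaleC_of_real[symmetric] scaleC_scaleC)
qed (simp_all add: scaleC_add_left norm_scaleC)

lemmas tendsto_scaleC = bounded_linear.tendsto[OF bounded_linear_scaleC]

text \<open>Three-epsilon argument: the bound on \<open>T n\<close> is uniform in \<open>n\<close>,
  so a point of \<open>D\<close> close to \<open>x\<close> controls \<open>T n x\<close> and
  \<open>T' x\<close> at once.\<close>

lemma tendsto_of_dense:
  fixes T :: "nat \<Rightarrow> 'a::real_normed_vector \<Rightarrow> 'b::real_normed_vector"
  assumes lin: "\<And>n. linear (T n)"
    and bd: "\<And>n x. norm (T n x) \<le> C * norm x"
    and lin': "linear T'" and bd': "\<And>x. norm (T' x) \<le> C' * norm x"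
    and conv: "\<And>x. x \<in> D \<Longrightarrow> (\<lambda>n. T n x) \<longlonglongrightarrow> T' x"
    and dense: "closure D = UNIV"
  shows "(\<lambda>n. T n x) \<longlonglongrightarrow> T' x"
proof (rule LIMSEQ_I)
  fix r :: real assume r: "r > 0"
  \<comment> \<open>The absolute values and the summand 1 make \<open>K\<close> positive, so that
    one can divide by it.\<close>
  define K where "K = \<bar>C\<bar> + \<bar>C'\<bar> + 1"
  have K: "K > 0" by (simp add: K_def)
  have "x \<in> closure D" using dense by simp
  then obtain d where d: "d \<in> D" "dist d x < r / (2 * K)"
    using r K unfolding closure_approachable by (metis divide_pos_pos zero_less_mult_iff zero_less_numeral)
  obtain N where N: "\<And>n. n \<ge> N \<Longrightarrow> norm (T n d - T' d) < r / 2"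
    using LIMSEQ_D[OF conv[OF d(1)], of "r/2"] r by auto
  have "norm (T n x - T' x) < r" if "n \<ge> N" for n
  proof -
    have "T n x - T' x = T n (x - d) - T' (x - d) + (T n d - T' d)"
      using linear_diff[OF lin] linear_diff[OF lin'] by simp
    then have "norm (T n x - T' x) \<le> norm (T n (x - d)) + norm (T' (x - d)) + norm (T n d - T' d)"
      by (metis (no_types, lifting) add_right_mono norm_triangle_ineq norm_triangle_ineq4 order_trans)
    also have "norm (T n (x - d)) \<le> \<bar>C\<bar> * norm (x - d)"
      by (rule order_trans[OF bd]) (simp add: mult_right_mono)
    also have "norm (T' (x - d)) \<le> \<bar>C'\<bar> * norm (x - d)"
      by (rule order_trans[OF bd']) (simp add: mult_right_mono)
    also have "\<bar>C\<bar> * norm (x - d) + \<bar>C'\<bar> * norm (x - d) \<le> K * norm (x - d)"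
      by (simp add: K_def algebra_simps)
    also have "K * norm (x - d) \<le> K * (r / (2 * K))"
      using d(2) K by (intro mult_left_mono) (auto simp: dist_norm norm_minus_commute)
    also have "\<dots> = r / 2" using K by simp
    finally show ?thesis using N[OF that] by simp
  qed
  then show "\<exists>N. \<forall>n\<ge>N. norm (T n x - T' x) < r" by blast
qed

text \<open>With no candidate for the limit, the same estimate yields a Cauchy sequence, and
  completeness of the target does the rest.\<close>

lemma convergent_of_dense:
  fixes T :: "nat \<Rightarrow> 'a::real_normed_vector \<Rightarrow> 'b::banach"
  assumes lin: "\<And>n. linear (T n)"
    and bd: "\<And>n x. norm (T n x) \<le> C * norm x"
    and conv: "\<And>x. x \<in> D \<Longrightarrow> convergent (\<lambda>n. T n x)"
    and dense: "closure D = UNIV"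
  shows "convergent (\<lambda>n. T n x)"
proof -
  have "Cauchy (\<lambda>n. T n x)"
  proof (rule CauchyI)
    fix r :: real assume r: "r > 0"
    define K where "K = \<bar>C\<bar> + 1"
    have K: "K > 0" by (simp add: K_def)
    have "x \<in> closure D" using dense by simp
    then obtain d where d: "d \<in> D" "dist d x < r / (4 * K)"
      using r K unfolding closure_approachable by (metis divide_pos_pos zero_less_mult_iff zero_less_numeral)
    have small: "norm (T n (x - d)) < r / 4" for n
    proof -
      have "norm (T n (x - d)) \<le> K * norm (x - d)"
        by (rule order_trans[OF bd]) (simp add: K_def mult_right_mono)
      also have "\<dots> < K * (r / (4 * K))"
        using d(2) K by (intro mult_strict_left_mono) (auto simp: dist_norm norm_minus_commute)
      also have "\<dots> = r / 4" using K by simp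
      finally show ?thesis .
    qed
    obtain N where N: "\<And>m n. m \<ge> N \<Longrightarrow> n \<ge> N \<Longrightarrow> norm (T m d - T n d) < r / 2"
      using CauchyD[OF convergent_Cauchy[OF conv[OF d(1)]], of "r/2"] r by auto
    have "norm (T m x - T n x) < r" if "m \<ge> N" "n \<ge> N" for m n
    proof -
      have "T m x - T n x = T m (x - d) - T n (x - d) + (T m d - T n d)"
        using linear_diff[OF lin] by simp
      then have "norm (T m x - T n x) \<le> norm (T m (x - d)) + norm (T n (x - d)) + norm (T m d - T n d)"
        by (metis (no_types, lifting) add_right_mono norm_triangle_ineq norm_triangle_ineq4 order_trans)
      then show ?thesis using small[of m] small[of n] N[OF that] by simp
    qed
    then show "\<exists>M. \<forall>m\<ge>M. \<forall>n\<ge>M. norm (T m x - T n x) < r" by blast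
  qed
  then show ?thesis by (rule Cauchy_convergent)
qed

text \<open>The limit at \<open>x\<close> is approximated by the limits at nearby points of
  \<open>D\<close>, which lie in the closed set \<open>R\<close>. With \<open>R\<close> the
  multiples of 1 in F, or the tensors \<open>t b 1\<close> in A, this fixes the form of the limits
  of averages.\<close>

lemma limit_in_closed:
  fixes T :: "nat \<Rightarrow> 'a::real_normed_vector \<Rightarrow> 'b::banach"
  assumes lin: "\<And>n. linear (T n)"
    and bd: "\<And>n x. norm (T n x) \<le> C * norm x"
    and conv: "\<And>x. x \<in> D \<Longrightarrow> \<exists>r\<in>R. (\<lambda>n. T n x) \<longlonglongrightarrow> r"
    and R: "closed R" and dense: "closure D = UNIV"
  shows "\<exists>r\<in>R. (\<lambda>n. T n x) \<longlonglongrightarrow> r"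
proof -
  have "convergent (\<lambda>n. T n x)"
    using lin bd _ dense by (rule convergent_of_dense) (use conv in \<open>auto simp: convergent_def\<close>)
  then obtain l where l: "(\<lambda>n. T n x) \<longlonglongrightarrow> l" by (auto simp: convergent_def)
  have "l \<in> closure R"
    unfolding closure_approachable
  proof (intro allI impI)
    fix \<epsilon> :: real assume \<epsilon>: "\<epsilon> > 0"
    define K where "K = \<bar>C\<bar> + 1"
    have K: "K > 0" by (simp add: K_def)
    have "x \<in> closure D" using dense by simp
    then obtain d where d: "d \<in> D" "dist d x < \<epsilon> / K"
      using \<epsilon> K unfolding closure_approachable by (metis divide_pos_pos)
    obtain r where r: "r \<in> R" "(\<lambda>n. T n d) \<longlonglongrightarrow> r" using conv[OF d(1)] by blast
    have "norm (T n d - T n x) \<le> K * norm (d - x)" for n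
    proof -
      have "norm (T n (d - x)) \<le> K * norm (d - x)"
        by (rule order_trans[OF bd]) (simp add: K_def mult_right_mono)
      then show ?thesis by (simp add: linear_diff[OF lin])
    qed
    then have "norm (r - l) \<le> K * norm (d - x)"
      using Lim_norm_ubound[OF _ tendsto_diff[OF r(2) l]] by simp
    also have "\<dots> < \<epsilon>" using d(2) K by (simp add: dist_norm field_simps)
    finally show "\<exists>y\<in>R. dist y l < \<epsilon>" using r(1) by (auto simp: dist_norm)
  qed
  then show ?thesis using l R by auto
qed

text \<open>Meant for the embeddings of the scalars into F and of B into A, whose ranges have to
  contain the limits of averages.\<close>

lemma closed_range_bounded_below:
  fixes f :: "'a::banach \<Rightarrow> 'b::banach"
  assumes "bounded_linear f" "c > 0" "\<And>x. c * norm x \<le> norm (f x)"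
  shows "closed (range f)"
  by (rule complete_imp_closed, rule complete_isometric_image[OF assms(2) subspace_UNIV assms(1)])
    (use assms(3) in \<open>auto simp: complete_UNIV mult.commute\<close>)

text \<open>A number above 1 has unbounded powers, and n \<le> 2^n makes the exponents 2^j
  sufficient. This strips a constant independent of j from an estimate obtained by repeated
  squaring.\<close>

lemma le_one_if_powers_bounded:
  fixes r :: real
  assumes "r \<ge> 0" "\<And>j. r ^ (2 ^ j) \<le> C"
  shows "r \<le> 1"
proof (rule ccontr)
  assume "\<not> r \<le> 1"
  then have "r > 1" by simp
  then obtain n where n: "C < r ^ n" using real_arch_pow by blast
  have "r ^ n \<le> r ^ (2 ^ n)"
    using \<open>r > 1\<close> by (intro power_increasing) (simp_all add: less_imp_le)
  then show False using n assms(2)[of n] by simp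
qed

text \<open>Orthogonality of the characters of the cyclic group of order k: for distinct indices
  this is a geometric sum whose ratio is a k-th root of unity other than 1.\<close>

lemma sum_powers_root_of_unity:
  fixes k i j :: nat
  assumes "i < k" "j < k"
  defines "\<omega> \<equiv> cis (2 * pi / real k)"
  shows "(\<Sum>r<k. \<omega> ^ (r * i) * cnj (\<omega> ^ (r * j))) = (if i = j then of_nat k else 0)"
proof -
  have k: "k > 0" using assms by simp
  have pow: "\<omega> ^ i = cis (2 * pi * real i / real k)" for i
    by (simp add: \<omega>_def Complex.DeMoivre algebra_simps)
  have cn: "\<omega> ^ i * cnj (\<omega> ^ i) = 1" for i
    by (simp add: pow cis_cnj cis_mult)
  define z where "z = \<omega> ^ i * cnj (\<omega> ^ j)"
  have "\<omega> ^ k = 1" using k by (simp add: pow)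
  then have zk: "z ^ k = 1"
    by (simp add: z_def power_mult_distrib flip: power_mult)
      (simp add: mult.commute[of _ k] power_mult complex_cnj_power[symmetric] del: complex_cnj_power)
  have sum: "(\<Sum>r<k. \<omega> ^ (r * i) * cnj (\<omega> ^ (r * j))) = (\<Sum>r<k. z ^ r)"
    by (rule sum.cong) (simp_all add: z_def power_mult_distrib mult.commute[of _ i] mult.commute[of _ j] power_mult)
  show ?thesis
  proof (cases "i = j")
    case True
    then have "z = 1" using cn[of i] by (simp add: z_def)
    then show ?thesis using sum True by simp
  next
    case False
    have "z \<noteq> 1"
    proof
      assume "z = 1"
      then have "\<omega> ^ i * (\<omega> ^ j * cnj (\<omega> ^ j)) = \<omega> ^ j" by (simp add: z_def algebra_simps)
      then have "\<omega> ^ i = \<omega> ^ j" by (simp only: cn mult_1_right)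
      moreover have "inj_on (\<lambda>k'. cis (2 * pi * real k' / real k)) {..<k}"
        using Complex.bij_betw_roots_unity[OF k] by (rule bij_betw_imp_inj_on)
      ultimately show False
        using False assms(1,2) by (auto simp: pow inj_on_def)
    qed
    then have "(\<Sum>r<k. z ^ r) = 0" using zk by (simp add: geometric_sum)
    then show ?thesis using sum False by simp
  qed
qed

section \<open>Matrix units and averaging\<close>

text \<open>The unit \<open>u\<close> is a parameter because the locale serves twice: for F with
  unit 1, and for A, whose type provides no 1 and whose unit is \<open>t 1 1\<close>.\<close>

locale matrix_units =
  fixes k :: nat and e :: "nat \<Rightarrow> nat \<Rightarrow> 'a::complex_banach_algebra" and u :: 'a
  assumes k_pos: "k > 0"
    and unit_mult: "\<lbrakk>i < k; j < k; p < k; q < k\<rbrakk> \<Longrightarrow> e i j * e p q = (if j = p then e i q else 0)"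
    and sum_diag: "(\<Sum>i<k. e i i) = u"
    and left_unit: "u * a = a" and right_unit: "a * u = a"
begin

definition csum :: "'a \<Rightarrow> 'a" where
  "csum a = (\<Sum>i<k. \<Sum>j<k. e i j * a * e j i)"

text \<open>The conditional expectation onto the commutant of the units; \<open>csum\<close> is its
  unnormalised form.\<close>

definition expect :: "'a \<Rightarrow> 'a" where
  "expect a = inverse (of_nat k) *\<^sub>C csum a"

lemma csum_expect: "csum a = of_nat k *\<^sub>C expect a"
  using k_pos by (simp add: expect_def scaleC_scaleC)

lemma csum_add: "csum (a + b) = csum a + csum b"
  by (simp add: csum_def algebra_simps sum.distrib)

lemma csum_scaleC: "csum (c *\<^sub>C a) = c *\<^sub>C csum a"
  by (simp add: csum_def sum_scaleC_right mult_scaleC_left mult_scaleC_right)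

lemma expect_add: "expect (a + b) = expect a + expect b"
  by (simp add: expect_def csum_add scaleC_add_right)

lemma expect_scaleC: "expect (c *\<^sub>C a) = c *\<^sub>C expect a"
  by (simp add: expect_def csum_scaleC scaleC_scaleC mult.commute)

lemma linear_expect: "linear expect"
  by (rule linearI) (simp_all add: expect_add expect_scaleC scaleC_of_real[symmetric])

lemma unit_mult_assoc:
  "\<lbrakk>i < k; j < k; p < k; q < k\<rbrakk> \<Longrightarrow> e i j * (e p q * a) = (if j = p then e i q * a else 0)"
  by (simp add: mult.assoc[symmetric] unit_mult)

text \<open>One of the two sums collapses. Multiplication from the right, in
  \<open>csum_unit\<close>, leads to the same expression, so the average commutes with the
  units.\<close>

lemma unit_csum:
  assumes "p < k" "q < k"
  shows "e p q * csum a = (\<Sum>j<k. e p j * a * e j q)"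
proof -
  have "e p q * csum a = (\<Sum>i<k. \<Sum>j<k. if q = i then e p j * a * e j i else 0)"
    unfolding csum_def sum_distrib_left
    using assms by (intro sum.cong refl) (simp add: mult.assoc unit_mult_assoc)
  also have "\<dots> = (\<Sum>i<k. if q = i then (\<Sum>j<k. e p j * a * e j i) else 0)"
    by (intro sum.cong refl) simp
  finally have "e p q * csum a = \<dots>" .
  then show ?thesis using assms by (simp add: sum.delta)
qed

lemma csum_unit:
  assumes "p < k" "q < k"
  shows "csum a * e p q = (\<Sum>j<k. e p j * a * e j q)"
proof -
  have "csum a * e p q = (\<Sum>i<k. if p = i then (\<Sum>j<k. e i j * a * e j q) else 0)"
    unfolding csum_def sum_distrib_right
    using assms by (intro sum.cong refl) (auto simp add: mult.assoc unit_mult intro!: sum.cong sum.neutral)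
  then show ?thesis using assms by (simp add: sum.delta)
qed

lemma expect_commute:
  assumes "p < k" "q < k" shows "e p q * expect a = expect a * e p q"
  using assms by (simp add: expect_def mult_scaleC_left mult_scaleC_right unit_csum csum_unit)

text \<open>Both sides collapse to the sum over i of \<open>e i q * a * e p i\<close>.\<close>

lemma csum_tracial:
  assumes "p < k" "q < k" shows "csum (a * e p q) = csum (e p q * a)"
proof -
  have "csum (a * e p q) = (\<Sum>i<k. \<Sum>j<k. if q = j then e i j * a * e p i else 0)"
    unfolding csum_def using assms
    by (intro sum.cong refl) (simp add: mult.assoc unit_mult)
  also have "\<dots> = (\<Sum>i<k. e i q * a * e p i)"
    using assms by (simp add: sum.delta)
  also have "\<dots> = (\<Sum>i<k. \<Sum>j<k. if j = p then e i q * a * e j i else 0)"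
    using assms by (simp add: sum.delta')
  also have "\<dots> = csum (e p q * a)"
    unfolding csum_def using assms
    by (intro sum.cong refl) (simp add: mult.assoc[symmetric] unit_mult)
  finally show ?thesis .
qed

lemma expect_tracial:
  assumes "p < k" "q < k" shows "expect (a * e p q) = expect (e p q * a)"
  using csum_tracial[OF assms] by (simp add: expect_def)

lemma sum_ed: "(\<Sum>i<k. \<Sum>j<k. e i j * e j i) = of_nat k *\<^sub>C u"
proof -
  have "(\<Sum>i<k. \<Sum>j<k. e i j * e j i) = (\<Sum>i<k. \<Sum>j<k. e i i)"
    by (intro sum.cong refl) (simp add: unit_mult)
  also have "\<dots> = (\<Sum>i<k. of_nat k *\<^sub>C e i i)"
    by (intro sum.cong refl) (simp add: scaleC_of_real[of "real k", simplified] scaleR_conv_of_real sum_constant_scaleR)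
  also have "\<dots> = of_nat k *\<^sub>C u" by (simp add: sum_scaleC_right[symmetric] sum_diag)
  finally show ?thesis .
qed

text \<open>The Casimir operator of the adjoint action is \<open>2k (id - expect)\<close>; so \<open>expect\<close> is built from
  commutators.\<close>

lemma casimir:
  "(\<Sum>i<k. \<Sum>j<k. e i j * (e j i * a - a * e j i) - (e j i * a - a * e j i) * e i j) =
    (2 * of_nat k) *\<^sub>C (a - expect a)"
proof -
  have 1: "(\<Sum>i<k. \<Sum>j<k. e i j * e j i * a) = of_nat k *\<^sub>C a"
    by (simp add: sum_distrib_right[symmetric] sum_ed mult_scaleC_left left_unit)
  have 2: "(\<Sum>i<k. \<Sum>j<k. a * (e j i * e i j)) = of_nat k *\<^sub>C a"
    by (subst sum.swap) (simp add: sum_distrib_left[symmetric] sum_ed mult_scaleC_right right_unit)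
  have 3: "(\<Sum>i<k. \<Sum>j<k. e j i * a * e i j) = csum a"
    unfolding csum_def by (rule sum.swap)
  have "(\<Sum>i<k. \<Sum>j<k. e i j * (e j i * a - a * e j i) - (e j i * a - a * e j i) * e i j) =
    (\<Sum>i<k. \<Sum>j<k. e i j * e j i * a) - csum a - (csum a - (\<Sum>i<k. \<Sum>j<k. a * (e j i * e i j)))"
    unfolding 3[symmetric] unfolding csum_def
    by (subst 3[unfolded csum_def]) (simp add: algebra_simps sum_subtractf sum.distrib)
  also have "\<dots> = of_nat k *\<^sub>C (a - expect a) + of_nat k *\<^sub>C (a - expect a)"
    by (simp add: 1 2 csum_expect complex_vector.scale_right_diff_distrib)
  finally show ?thesis by (simp add: scaleC_add_left[symmetric])
qed

text \<open>The left side of \<open>casimir\<close> is a sum of double commutators of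
  \<open>a\<close>, hence in \<open>L\<close>; dividing by 2k puts \<open>a - expect a\<close> into
  \<open>L\<close>.\<close>

lemma expect_lie:
  assumes L: "csubspace L" "\<And>b x. x \<in> L \<Longrightarrow> b * x - x * b \<in> L" and a: "a \<in> L"
  shows "expect a \<in> L"
proof -
  have "(2 * of_nat k) *\<^sub>C (a - expect a) \<in> L"
    unfolding casimir[symmetric]
    by (intro complex_vector.subspace_sum L a)
  then have "inverse (2 * of_nat k) *\<^sub>C ((2 * of_nat k) *\<^sub>C (a - expect a)) \<in> L"
    by (rule complex_vector.subspace_scale[OF L(1)])
  then have "a - expect a \<in> L"
    using k_pos by (simp add: scaleC_scaleC)
  then have "a - (a - expect a) \<in> L"
    using a L(1) complex_vector.subspace_diff by blast
  then show ?thesis by simp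
qed

text \<open>Up to the factor 1/k the element is \<open>e a d * z * e c b\<close>. It is reached from
  \<open>z\<close> by commutators with \<open>e c b\<close> and \<open>e a d\<close>, followed by
  cutting down to a corner, which commutators also achieve. This is the case from which general
  traceless factors are generated later.\<close>

lemma unit_expect_lie:
  assumes L: "csubspace L" "\<And>b x. x \<in> L \<Longrightarrow> b * x - x * b \<in> L" and z: "z \<in> L"
    and idx: "a < k" "b < k" "c < k" "d < k" and ab: "a \<noteq> b" and cd: "c \<noteq> d"
  shows "e a b * expect (z * e c d) \<in> L"
proof -
  \<comment> \<open>For the orthogonal idempotents p and q let t = [p, [q, s]]. Then t + [p, t] = -2
    p s q, so the corner p s q is a combination of iterated commutators.\<close>
  have offdiag: "e a a * s * e b b \<in> L" if s: "s \<in> L" for s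
  proof -
    let ?p = "e a a" and ?q = "e b b"
    let ?s = "?q * s - s * ?q"
    let ?t = "?p * ?s - ?s * ?p"
    have "?t \<in> L" by (intro L s)
    have t: "?t = - (?p * s * ?q + ?q * s * ?p)"
    proof -
      have "?t = ?p * ?q * s - ?p * s * ?q - ?q * s * ?p + s * (?q * ?p)"
        by (simp add: algebra_simps)
      then show ?thesis using idx ab by (simp add: unit_mult)
    qed
    have "?p * ?t - ?t * ?p \<in> L" by (intro L s)
    have t': "?p * ?t - ?t * ?p = - (?p * s * ?q) + ?q * s * ?p"
    proof -
      have "?p * ?t - ?t * ?p = - (?p * ?p) * s * ?q - (?p * ?q) * s * ?p + ?p * s * (?q * ?p) + ?q * s * (?p * ?p)"
        unfolding t by (simp add: algebra_simps)
      then show ?thesis using idx ab by (simp add: unit_mult)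
    qed
    have "inverse 2 *\<^sub>C (- (?t + (?p * ?t - ?t * ?p))) \<in> L"
      using \<open>?t \<in> L\<close> \<open>?p * ?t - ?t * ?p \<in> L\<close> L(1)
      by (intro complex_vector.subspace_scale complex_vector.subspace_neg complex_vector.subspace_add)
    also have "- (?t + (?p * ?t - ?t * ?p)) = ?p * s * ?q + ?p * s * ?q"
      unfolding t' unfolding t by (simp add: algebra_simps)
    also have "\<dots> = 2 *\<^sub>C (?p * s * ?q)"
      by (rule scaleC_double[symmetric])
    finally show ?thesis by (simp add: scaleC_scaleC)
  qed
  let ?e = "e a d" and ?f = "e c b"
  let ?s = "?f * z - z * ?f"
  \<comment> \<open>In this double commutator the terms with \<open>?e * ?f\<close> and
    \<open>?f * ?e\<close> vanish, because d \<noteq> c and b \<noteq> a.\<close>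
  have "- (?e * ?s - ?s * ?e) \<in> L" using L z by (intro complex_vector.subspace_neg L)
  also have "- (?e * ?s - ?s * ?e) = - (?e * ?f * z) + ?e * z * ?f + ?f * z * ?e - z * (?f * ?e)"
    by (simp add: algebra_simps)
  also have "\<dots> = ?e * z * ?f + ?f * z * ?e"
    using idx ab cd by (simp add: unit_mult)
  finally have "e a a * (?e * z * ?f + ?f * z * ?e) * e b b \<in> L" by (rule offdiag)
  also have "e a a * (?e * z * ?f + ?f * z * ?e) * e b b =
      (e a a * ?e) * z * (?f * e b b) + (e a a * ?f) * z * (?e * e b b)"
    by (simp add: algebra_simps)
  \<comment> \<open>The second summand survives only if a = c and d = b, and then it coincides with
    the first.\<close>
  also have "\<dots> = (if a = c \<and> d = b then 2 else 1) *\<^sub>C (?e * z * ?f)"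
    using idx by (auto simp: unit_mult scaleC_double)
  finally have "(if a = c \<and> d = b then 2 else 1) *\<^sub>C (?e * z * ?f) \<in> L" .
  then have "inverse (of_nat k) *\<^sub>C inverse (if a = c \<and> d = b then 2 else 1) *\<^sub>C
      (if a = c \<and> d = b then 2 else 1) *\<^sub>C (?e * z * ?f) \<in> L"
    using L(1) complex_vector.subspace_scale by blast
  then have in_L: "inverse (of_nat k) *\<^sub>C (?e * z * ?f) \<in> L"
    by (simp add: scaleC_scaleC split: if_splits)
  have "e a b * csum (z * e c d) = (\<Sum>j<k. if j = d then ?e * z * ?f else 0)"
    unfolding unit_csum[OF idx(1,2)] using idx
    by (intro sum.cong refl) (auto simp: mult.assoc unit_mult)
  also have "\<dots> = ?e * z * ?f" using idx by (simp add: sum.delta)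
  finally show ?thesis using in_L by (simp add: expect_def mult_scaleC_right)
qed

text \<open>Products of diagonal unitaries with cyclic shifts. Averaging over them yields \<open>expect\<close>, whose norm
  is therefore bounded independently of \<open>k\<close>.\<close>

definition weyl :: "nat \<Rightarrow> nat \<Rightarrow> 'a" where
  "weyl r s = (\<Sum>i<k. cis (2 * pi / real k) ^ (r * i) *\<^sub>C e i ((i + s) mod k))"

text \<open>The other factor of the conjugation, written out because A carries no involution; in F
  it is the adjoint of \<open>weyl r s\<close>.\<close>

definition weyl' :: "nat \<Rightarrow> nat \<Rightarrow> 'a" where
  "weyl' r s = (\<Sum>i<k. cnj (cis (2 * pi / real k) ^ (r * i)) *\<^sub>C e ((i + s) mod k) i)"

lemma inj_on_shift: "inj_on (\<lambda>s. (i + s) mod k) {..<k}"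
proof (rule inj_onI)
  fix s s' assume "s \<in> {..<k}" "s' \<in> {..<k}" "(i + s) mod k = (i + s') mod k"
  then show "s = s'"
    by (auto simp: nat_mod_eq_iff) (metis mod_less mod_mult_self2)
qed

lemma bij_betw_shift: "bij_betw (\<lambda>s. (i + s) mod k) {..<k} {..<k}"
proof -
  have "(\<lambda>s. (i + s) mod k) ` {..<k} = {..<k}"
    using k_pos by (intro card_subset_eq) (auto simp: card_image inj_on_shift)
  then show ?thesis using inj_on_shift by (simp add: bij_betw_def)
qed

lemma shift_eq_iff: "i < k \<Longrightarrow> j < k \<Longrightarrow> (i + s) mod k = (j + s) mod k \<longleftrightarrow> i = j"
  using inj_on_eq_iff[OF inj_on_shift, of i j s] by (simp add: add.commute[of _ s])

lemma weyl_mult: "weyl r s * weyl' r s = u"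
proof -
  let ?w = "cis (2 * pi / real k)"
  have cn: "?w ^ n * cnj (?w ^ n) = 1" "cnj (?w ^ n) * ?w ^ n = 1" for n
    by (simp_all add: Complex.DeMoivre cis_cnj cis_mult del: complex_cnj_power)
  have "weyl r s * weyl' r s = (\<Sum>i<k. \<Sum>j<k. if j = i then e i j else 0)"
    unfolding weyl_def weyl'_def sum_product
    by (intro sum.cong refl)
      (auto simp: mult_scaleC_left mult_scaleC_right scaleC_scaleC unit_mult shift_eq_iff k_pos cn
        simp del: complex_cnj_power)
  also have "\<dots> = u" by (simp add: sum.delta sum_diag)
  finally show ?thesis .
qed

text \<open>Summation over \<open>r\<close> removes all terms with distinct row indices, by
  orthogonality of characters. Summation over \<open>s\<close> then lets i + s run through all
  residues modulo k, which leaves k times \<open>csum a\<close>.\<close>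

lemma expect_average:
  "expect a = inverse (of_nat k ^ 2) *\<^sub>C (\<Sum>s<k. \<Sum>r<k. weyl r s * a * weyl' r s)"
proof -
  let ?w = "cis (2 * pi / real k)"
  have "(\<Sum>r<k. weyl r s * a * weyl' r s) =
      of_nat k *\<^sub>C (\<Sum>i<k. e i ((i + s) mod k) * a * e ((i + s) mod k) i)" for s
  proof -
    have "(\<Sum>r<k. weyl r s * a * weyl' r s) = (\<Sum>r<k. \<Sum>i<k. \<Sum>j<k. (?w ^ (r * i) * cnj (?w ^ (r * j))) *\<^sub>C
        (e i ((i + s) mod k) * a * e ((j + s) mod k) j))"
      unfolding weyl_def weyl'_def sum_distrib_right sum_product
      by (intro sum.cong refl) (simp add: mult_scaleC_left mult_scaleC_right scaleC_scaleC
        mult.commute sum_distrib_left sum_distrib_right sum_scaleC_right del: complex_cnj_power)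
    also have "\<dots> = (\<Sum>i<k. \<Sum>r<k. \<Sum>j<k. (?w ^ (r * i) * cnj (?w ^ (r * j))) *\<^sub>C
        (e i ((i + s) mod k) * a * e ((j + s) mod k) j))"
      by (rule sum.swap)
    also have "\<dots> = (\<Sum>i<k. \<Sum>j<k. \<Sum>r<k. (?w ^ (r * i) * cnj (?w ^ (r * j))) *\<^sub>C
        (e i ((i + s) mod k) * a * e ((j + s) mod k) j))"
      by (rule sum.cong[OF refl], rule sum.swap)
    also have "\<dots> = (\<Sum>i<k. \<Sum>j<k. (\<Sum>r<k. ?w ^ (r * i) * cnj (?w ^ (r * j))) *\<^sub>C
        (e i ((i + s) mod k) * a * e ((j + s) mod k) j))"
      by (simp only: complex_vector.scale_sum_left)
    also have "\<dots> = (\<Sum>i<k. \<Sum>j<k. if i = j then of_nat k *\<^sub>C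
        (e i ((i + s) mod k) * a * e ((j + s) mod k) j) else 0)"
      by (intro sum.cong refl) (simp add: sum_powers_root_of_unity del: complex_cnj_power)
    finally show ?thesis by (simp add: sum.delta sum_scaleC_right)
  qed
  then have "(\<Sum>s<k. \<Sum>r<k. weyl r s * a * weyl' r s) =
      of_nat k *\<^sub>C (\<Sum>s<k. \<Sum>i<k. e i ((i + s) mod k) * a * e ((i + s) mod k) i)"
    by (simp add: sum_scaleC_right)
  also have "(\<Sum>s<k. \<Sum>i<k. e i ((i + s) mod k) * a * e ((i + s) mod k) i) = csum a"
    unfolding csum_def
    by (subst (1) sum.swap, rule sum.cong[OF refl])
      (rule sum.reindex_bij_betw[OF bij_betw_shift, where g = "\<lambda>j. e _ j * a * e j _"])
  finally show ?thesis
    using k_pos by (simp add: expect_def scaleC_scaleC power2_eq_square)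
qed

text \<open>There are k^2 conjugations, each of norm at most \<open>C\<^sup>2 * norm a\<close>,
  against the factor 1/k^2 in \<open>expect_average\<close>.\<close>

lemma norm_expect:
  assumes "\<And>r s. norm (weyl r s) \<le> C" "\<And>r s. norm (weyl' r s) \<le> C"
  shows "norm (expect a) \<le> C\<^sup>2 * norm a"
proof -
  have C: "C \<ge> 0" using assms(1)[of 0 0] norm_ge_zero order_trans by blast
  have "norm (\<Sum>s<k. \<Sum>r<k. weyl r s * a * weyl' r s) \<le> (\<Sum>s<k. \<Sum>r<k. C\<^sup>2 * norm a)"
  proof (intro sum_norm_le)
    fix r s
    have "norm (weyl r s * a * weyl' r s) \<le> norm (weyl r s) * norm a * norm (weyl' r s)"
      by (meson mult_right_mono norm_ge_zero norm_mult_ineq order_trans)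
    also have "\<dots> \<le> C * norm a * C"
      using assms C by (intro mult_mono) auto
    finally show "norm (weyl r s * a * weyl' r s) \<le> C\<^sup>2 * norm a"
      by (simp add: power2_eq_square algebra_simps)
  qed
  also have "\<dots> = (real k)\<^sup>2 * (C\<^sup>2 * norm a)" by (simp add: power2_eq_square)
  finally have "inverse ((real k)\<^sup>2) * norm (\<Sum>s<k. \<Sum>r<k. weyl r s * a * weyl' r s) \<le>
      inverse ((real k)\<^sup>2) * ((real k)\<^sup>2 * (C\<^sup>2 * norm a))"
    by (intro mult_left_mono) auto
  also have "\<dots> = C\<^sup>2 * norm a" using k_pos by simp
  finally show ?thesis
    by (simp add: expect_average norm_scaleC norm_inverse norm_power)
qed

end

section \<open>C*-algebras and matrix units\<close>

lemma star_zero [simp]: "star (0 :: 'f::cstar_algebra) = 0"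
  using star_add[of 0 "0 :: 'f"] by simp

lemma star_minus: "star (- x) = - star (x :: 'f::cstar_algebra)"
  using star_add[of x "- x"] by (simp add: eq_neg_iff_add_eq_0 add.commute)

lemma star_diff: "star (x - y) = star x - star (y :: 'f::cstar_algebra)"
  using star_add[of x "- y"] by (simp add: star_minus)

lemma star_sum: "star (\<Sum>i\<in>A. f i) = (\<Sum>i\<in>A. star (f i :: 'f::cstar_algebra))"
  by (induction A rule: infinite_finite_induct) (simp_all add: star_add)

text \<open>The C*-identity and submultiplicativity bound the norm of \<open>x\<close> by that of
  \<open>star x\<close>; applying this to \<open>star x\<close> as well gives equality.\<close>

lemma norm_star: "norm (star x) = norm (x :: 'f::cstar_algebra)"
proof -
  have le: "norm x \<le> norm (star x)" for x :: 'f
  proof (cases "norm x = 0")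
    case False
    have "norm x * norm x \<le> norm (star x) * norm x"
      using cstar_identity[of x] norm_mult_ineq[of "star x" x] by (simp add: power2_eq_square)
    then show ?thesis using False by simp
  qed simp
  show ?thesis using le[of x] le[of "star x"] by (simp add: star_star)
qed

lemma bounded_linear_star: "bounded_linear (star :: 'f::cstar_algebra \<Rightarrow> 'f)"
  by (rule bounded_linear_intro[of _ 1])
    (simp_all add: star_add star_scaleC norm_star scaleC_of_real[symmetric])

lemma star_one [simp]: "star 1 = (1 :: 'f::unital_cstar_algebra)"
  by (metis mult_1_left mult_1_right star_mult star_star)

text \<open>The C*-identity makes this norm a root of r^2 = r; the value 0 occurs in the zero
  algebra.\<close>

lemma norm_one_cstar: "norm (1 :: 'f::unital_cstar_algebra) \<le> 1"
proof -
  have "(norm (1 :: 'f))\<^sup>2 = norm (1 :: 'f)" using cstar_identity[of "1 :: 'f"] by simp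
  then show ?thesis by (auto simp: power2_eq_square)
qed

lemma mult_mat_unit:
  assumes "i < k" "j < k" "p < k" "q < (k::nat)"
  shows "mat k k (\<lambda>(a,b). if a = i \<and> b = j then 1 else 0) * mat k k (\<lambda>(a,b). if a = p \<and> b = q then 1 else 0) =
    (if j = p then mat k k (\<lambda>(a,b). if a = i \<and> b = q then 1 else 0) else 0\<^sub>m k k :: complex mat)"
proof (rule eq_matI)
  fix a b assume "a < dim_row (if j = p then mat k k (\<lambda>(a,b). if a = i \<and> b = q then 1 else 0) else 0\<^sub>m k k :: complex mat)"
    "b < dim_col (if j = p then mat k k (\<lambda>(a,b). if a = i \<and> b = q then 1 else 0) else 0\<^sub>m k k :: complex mat)"
  then have ab: "a < k" "b < k" by (auto split: if_splits)
  have "(mat k k (\<lambda>(a,b). if a = i \<and> b = j then 1 else 0) * mat k k (\<lambda>(a,b). if a = p \<and> b = q then 1 else 0 :: complex)) $$ (a, b) =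
    (\<Sum>l = 0..<k. (if a = i \<and> l = j then 1 else 0) * (if l = p \<and> b = q then 1 else 0))"
    using ab by (simp add: scalar_prod_def)
  also have "\<dots> = (\<Sum>l = 0..<k. if l = j then (if a = i \<and> b = q \<and> j = p then 1 else 0) else 0)"
    by (rule sum.cong) auto
  also have "\<dots> = (if a = i \<and> b = q \<and> j = p then 1 else 0)"
    using assms by (simp add: sum.delta)
  finally show "(mat k k (\<lambda>(a,b). if a = i \<and> b = j then 1 else 0) * mat k k (\<lambda>(a,b). if a = p \<and> b = q then 1 else 0)) $$ (a, b) =
    (if j = p then mat k k (\<lambda>(a,b). if a = i \<and> b = q then 1 else 0) else 0\<^sub>m k k :: complex mat) $$ (a, b)"
    using ab by simp
qed auto

text \<open>The standard matrix units are pulled back along the isomorphism. All relations,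
  including the value of the adjoint, are verified after applying \<phi>, which is injective on
  \<open>S\<close>.\<close>

lemma matrix_units_exist:
  fixes S :: "'f::unital_cstar_algebra set"
  assumes iso: "isomorphic_to_full_matrix_algebra S k" and sub: "cstar_subalgebra S" and one: "1 \<in> S"
  shows "\<exists>e. (\<forall>i<k. \<forall>j<k. e i j \<in> S \<and> star (e i j) = e j i) \<and>
    (\<forall>i<k. \<forall>j<k. \<forall>p<k. \<forall>q<k. e i j * e p q = (if j = p then e i q else 0)) \<and>
    (\<Sum>i<k. e i i) = 1 \<and> (\<forall>x\<in>S. \<exists>c. x = (\<Sum>i<k. \<Sum>j<k. c i j *\<^sub>C e i j)) \<and> (k > 0 \<longrightarrow> (1 :: 'f) \<noteq> 0)"
proof -
  obtain \<phi> where bij: "bij_betw \<phi> S (carrier_mat k k)"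
    and add: "\<And>x y. x \<in> S \<Longrightarrow> y \<in> S \<Longrightarrow> \<phi> (x + y) = \<phi> x + \<phi> y"
    and mult: "\<And>x y. x \<in> S \<Longrightarrow> y \<in> S \<Longrightarrow> \<phi> (x * y) = \<phi> x * \<phi> y"
    and scale: "\<And>x c. x \<in> S \<Longrightarrow> \<phi> (c *\<^sub>C x) = c \<cdot>\<^sub>m \<phi> x"
    and star: "\<And>x. x \<in> S \<Longrightarrow> \<phi> (star x) = map_mat cnj (transpose_mat (\<phi> x))"
    using iso unfolding isomorphic_to_full_matrix_algebra_def by blast
  have csub: "csubspace S" using sub by (simp add: cstar_subalgebra_def)
  have S_mult: "x * y \<in> S" if "x \<in> S" "y \<in> S" for x y
    using sub that by (simp add: cstar_subalgebra_def)
  have S_star: "star x \<in> S" if "x \<in> S" for x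
    using sub that by (simp add: cstar_subalgebra_def)
  note S_ops = complex_vector.subspace_0[OF csub] complex_vector.subspace_add[OF csub]
    complex_vector.subspace_scale[OF csub] complex_vector.subspace_sum[OF csub]
  have inj: "x = y" if "\<phi> x = \<phi> y" "x \<in> S" "y \<in> S" for x y
    using bij that by (meson bij_betw_imp_inj_on inj_onD)
  have carrier: "\<phi> x \<in> carrier_mat k k" if "x \<in> S" for x
    using bij that bij_betwE by blast
  have dims: "dim_row (\<phi> x) = k" "dim_col (\<phi> x) = k" if "x \<in> S" for x
    using carrier[OF that] by auto
  have phi0: "\<phi> 0 = 0\<^sub>m k k"
  proof -
    have "\<phi> (0 *\<^sub>C 0) = 0 \<cdot>\<^sub>m \<phi> 0" by (rule scale) (rule S_ops)
    then have "\<phi> 0 = 0 \<cdot>\<^sub>m \<phi> 0" by simp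
    also have "\<dots> = 0\<^sub>m k k" by (rule eq_matI) (use dims[OF S_ops(1)] in auto)
    finally show ?thesis .
  qed
  define U where "U i j = (mat k k (\<lambda>(a,b). if a = i \<and> b = j then 1 else 0) :: complex mat)" for i j
  have U_carrier: "U i j \<in> carrier_mat k k" for i j by (simp add: U_def)
  define e where "e i j = inv_into S \<phi> (U i j)" for i j
  have eS: "e i j \<in> S" and phie: "\<phi> (e i j) = U i j" for i j
    using bij_betw_inv_into_right[OF bij U_carrier] inv_into_into[of "U i j" \<phi> S] bij U_carrier
    by (auto simp: e_def bij_betw_def)
  have phi_sum: "\<phi> (\<Sum>i\<in>A. f i) $$ (a, b) = (\<Sum>i\<in>A. \<phi> (f i) $$ (a, b))"
    if "\<And>i. i \<in> A \<Longrightarrow> f i \<in> S" "a < k" "b < k" for A :: "nat set" and f a b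
    using that(1)
  proof (induction A rule: infinite_finite_induct)
    case (insert i A)
    then have "(\<Sum>i\<in>A. f i) \<in> S" by (intro S_ops) auto
    then show ?case using insert that(2,3) by (simp add: add dims)
  qed (use that in \<open>simp_all add: phi0\<close>)
  have phi_exp: "\<phi> (\<Sum>i<k. \<Sum>j<k. c i j *\<^sub>C e i j) $$ (a, b) = c a b" if "a < k" "b < k" for c a b
  proof -
    have "\<phi> (\<Sum>i<k. \<Sum>j<k. c i j *\<^sub>C e i j) $$ (a, b) = (\<Sum>i<k. \<Sum>j<k. \<phi> (c i j *\<^sub>C e i j) $$ (a, b))"
      using that by (simp add: phi_sum S_ops eS)
    also have "\<dots> = (\<Sum>i<k. \<Sum>j<k. if j = b then if i = a then c a b else 0 else 0)"
      using that by (intro sum.cong refl) (auto simp: scale eS phie U_def)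
    finally show ?thesis using that by (simp add: sum.delta)
  qed
  have exp: "x = (\<Sum>i<k. \<Sum>j<k. \<phi> x $$ (i, j) *\<^sub>C e i j)" if x: "x \<in> S" for x
  proof (rule inj)
    show "(\<Sum>i<k. \<Sum>j<k. \<phi> x $$ (i, j) *\<^sub>C e i j) \<in> S" by (intro S_ops eS)
    from dims[OF this] show "\<phi> x = \<phi> (\<Sum>i<k. \<Sum>j<k. \<phi> x $$ (i, j) *\<^sub>C e i j)"
      by (intro eq_matI) (simp_all add: phi_exp dims x)
  qed (fact x)
  have expE: "\<exists>c. x = (\<Sum>i<k. \<Sum>j<k. c i j *\<^sub>C e i j)" if "x \<in> S" for x
    by (rule exI[of _ "\<lambda>i j. \<phi> x $$ (i, j)"]) (rule exp[OF that])
  \<comment> \<open>Preservation of the unit is not part of the isomorphism. It follows by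
    multiplying \<phi>(1) with the image of a preimage of the identity matrix.\<close>
  have phi1: "\<phi> 1 = 1\<^sub>m k"
  proof -
    obtain y where y: "y \<in> S" "\<phi> y = 1\<^sub>m k"
      using bij by (metis bij_betw_iff_bijections one_carrier_mat)
    have "\<phi> 1 = \<phi> 1 * \<phi> y" using carrier[OF one] y by simp
    also have "\<dots> = 1\<^sub>m k" using mult[OF one y(1)] y by simp
    finally show ?thesis .
  qed
  have "1 = (\<Sum>i<k. \<Sum>j<k. if i = j then e i j else 0)"
    by (subst exp[OF one], intro sum.cong refl) (simp add: phi1)
  then have sum1: "(\<Sum>i<k. e i i) = 1" by (simp add: sum.delta)
  have emult: "e i j * e p q = (if j = p then e i q else 0)" if "i < k" "j < k" "p < k" "q < k" for i j p q
  proof (rule inj)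
    show "\<phi> (e i j * e p q) = \<phi> (if j = p then e i q else 0)"
      using mult_mat_unit[OF that] by (simp add: mult eS phie phi0 U_def)
  qed (auto intro: S_mult eS S_ops)
  have estar: "star (e i j) = e j i" if "i < k" "j < k" for i j
  proof (rule inj)
    show "\<phi> (star (e i j)) = \<phi> (e j i)"
      by (simp add: star eS phie U_def) (rule eq_matI, auto)
  qed (auto intro: S_star eS)
  have nz: "(1 :: 'f) \<noteq> 0" if "k > 0"
  proof
    assume "(1 :: 'f) = 0"
    then have "1\<^sub>m k $$ (0, 0) = (0\<^sub>m k k $$ (0, 0) :: complex)" using phi1 phi0 by simp
    then show False using that by simp
  qed
  show ?thesis
    by (intro exI[of _ e] conjI allI impI ballI) (use eS emult estar sum1 nz expE in auto)
qed

section \<open>The average on the span of the matrix units\<close>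

context matrix_units
begin

lemma expect_unit:
  assumes "p < k" "q < k"
  shows "expect (e p q) = (if p = q then inverse (of_nat k) *\<^sub>C u else 0)"
proof -
  have "csum (e p q) = (\<Sum>i<k. \<Sum>j<k. if j = p then (if p = q then e i i else 0) else 0)"
    unfolding csum_def using assms by (intro sum.cong refl) (auto simp: unit_mult)
  also have "\<dots> = (if p = q then u else 0)"
    using assms by (simp add: sum.delta sum_diag)
  finally show ?thesis by (simp add: expect_def)
qed

lemma expect_zero: "expect 0 = 0"
  by (rule linear_0[OF linear_expect])

lemma expect_sum: "expect (\<Sum>i\<in>A. f i) = (\<Sum>i\<in>A. expect (f i))"
  by (rule linear_sum[OF linear_expect])

text \<open>Off-diagonal units average to 0 and diagonal ones to 1/k, so on matrices the average is
  the normalised matrix trace.\<close>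

lemma expect_combination:
  "expect (\<Sum>i<k. \<Sum>j<k. c i j *\<^sub>C e i j) = (inverse (of_nat k) * (\<Sum>i<k. c i i)) *\<^sub>C u"
proof -
  have "expect (\<Sum>i<k. \<Sum>j<k. c i j *\<^sub>C e i j) =
      (\<Sum>i<k. \<Sum>j<k. if i = j then (inverse (of_nat k) * c i i) *\<^sub>C u else 0)"
    unfolding expect_sum expect_scaleC
    by (intro sum.cong refl) (auto simp: expect_unit scaleC_scaleC mult.commute)
  also have "\<dots> = (\<Sum>i<k. (inverse (of_nat k) * c i i) *\<^sub>C u)"
    by (simp add: sum.delta)
  finally show ?thesis
    by (simp add: complex_vector.scale_sum_left[symmetric] sum_distrib_left)
qed

lemma expect_u: "expect u = u"
proof -
  have "expect u = (\<Sum>i<k. inverse (of_nat k) *\<^sub>C u)"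
    unfolding sum_diag[symmetric] expect_sum by (intro sum.cong refl) (simp add: expect_unit sum_diag)
  also have "\<dots> = (\<Sum>i<k. inverse (of_nat k)) *\<^sub>C u"
    by (simp only: complex_vector.scale_sum_left)
  finally show ?thesis using k_pos by simp
qed

end

locale cstar_matrix_units = matrix_units k e 1
  for k :: nat and e :: "nat \<Rightarrow> nat \<Rightarrow> 'f::unital_cstar_algebra" +
  assumes star_unit: "\<lbrakk>i < k; j < k\<rbrakk> \<Longrightarrow> star (e i j) = e j i"
begin

lemma star_weyl: "star (weyl r s) = weyl' r s" "star (weyl' r s) = weyl r s"
  using k_pos by (simp_all add: weyl_def weyl'_def star_sum star_scaleC star_unit)

text \<open>Since \<open>weyl r s\<close> is the adjoint of \<open>weyl' r s\<close>, the relation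
  \<open>weyl_mult\<close> and the C*-identity give the bound.\<close>

lemma norm_weyl: "norm (weyl r s) \<le> 1" "norm (weyl' r s) \<le> 1"
proof -
  have "(norm (weyl' r s))\<^sup>2 \<le> 1"
    using cstar_identity[of "weyl' r s"] norm_one_cstar[where 'f = 'f] by (simp add: star_weyl weyl_mult)
  then show "norm (weyl' r s) \<le> 1" by (simp add: power2_nonneg_ge_1_iff abs_square_le_1)
  then show "norm (weyl r s) \<le> 1" using norm_star[of "weyl r s"] by (simp add: star_weyl)
qed

lemma norm_expect_le: "norm (expect a) \<le> norm a"
  using norm_expect[of 1 a] norm_weyl by simp

text \<open>The projection \<open>e j j\<close> has norm 0 or 1, and
  \<open>star (e i j) * e i j\<close> is \<open>e j j\<close>.\<close>

lemma norm_unit_le: assumes "i < k" "j < k" shows "norm (e i j) \<le> 1"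
proof -
  have "(norm (e j j))\<^sup>2 = norm (e j j)"
    using cstar_identity[of "e j j"] assms by (simp add: star_unit unit_mult)
  then have "norm (e j j) \<le> 1" by (auto simp: power2_eq_square)
  moreover have "(norm (e i j))\<^sup>2 = norm (e j j)"
    using cstar_identity[of "e i j"] assms by (simp add: star_unit unit_mult)
  ultimately show ?thesis by (metis abs_norm_cancel abs_square_le_1)
qed

end

section \<open>The trace of a UHF algebra\<close>

text \<open>One system of matrix units is fixed at each level. The subalgebras are nested, but the
  units of different levels are not tied to each other.\<close>

locale uhf_system =
  fixes S :: "nat \<Rightarrow> 'f::unital_cstar_algebra set"
    and k :: "nat \<Rightarrow> nat" and e :: "nat \<Rightarrow> nat \<Rightarrow> nat \<Rightarrow> 'f"
  assumes incseq: "incseq S"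
    and subalgebra: "cstar_subalgebra (S n)"
    and one_in: "1 \<in> S n"
    and dense: "closure (\<Union>n. S n) = UNIV"
    and one_neq_zero: "(1 :: 'f) \<noteq> 0"
    and unit_in: "\<lbrakk>i < k n; j < k n\<rbrakk> \<Longrightarrow> e n i j \<in> S n"
    and expansion: "x \<in> S n \<Longrightarrow> \<exists>c. x = (\<Sum>i<k n. \<Sum>j<k n. c i j *\<^sub>C e n i j)"
    and units: "cstar_matrix_units (k n) (e n)"

sublocale uhf_system \<subseteq> mu: cstar_matrix_units "k n" "e n" for n
  by (rule units)

lemma uhf_system_exists:
  assumes "uhf_algebra TYPE('f::unital_cstar_algebra)"
  shows "\<exists>(S :: nat \<Rightarrow> 'f set) k e. uhf_system S k e"
proof -
  obtain S :: "nat \<Rightarrow> 'f set" where S: "incseq S" "\<And>n. cstar_subalgebra (S n)" "\<And>n. 1 \<in> S n"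
    "\<And>n. \<exists>k\<ge>1. isomorphic_to_full_matrix_algebra (S n) k" "closure (\<Union>n. S n) = UNIV"
    using assms unfolding uhf_algebra_def by blast
  obtain k where k: "\<And>n. k n \<ge> 1" "\<And>n. isomorphic_to_full_matrix_algebra (S n) (k n)"
    using S(4) by metis
  define U where "U n e \<longleftrightarrow> (\<forall>i<k n. \<forall>j<k n. e i j \<in> S n \<and> star (e i j) = e j i) \<and>
    (\<forall>i<k n. \<forall>j<k n. \<forall>p<k n. \<forall>q<k n. e i j * e p q = (if j = p then e i q else 0)) \<and>
    (\<Sum>i<k n. e i i) = 1 \<and> (\<forall>x\<in>S n. \<exists>c. x = (\<Sum>i<k n. \<Sum>j<k n. c i j *\<^sub>C e i j)) \<and>
    (k n > 0 \<longrightarrow> (1 :: 'f) \<noteq> 0)" for n e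
  have "\<exists>e. U n e" for n
    using matrix_units_exist[OF k(2) S(2,3)] unfolding U_def .
  then obtain e where e: "\<And>n. U n (e n)" by metis
  have "cstar_matrix_units (k n) (e n)" for n
    using e[of n] k(1)[of n] unfolding U_def by unfold_locales (simp_all add: Suc_le_eq)
  moreover have "(1 :: 'f) \<noteq> 0"
    using e[of 0] k(1)[of 0] unfolding U_def by simp
  ultimately have "uhf_system S k e"
    using S(1-3,5) e unfolding U_def by (intro uhf_system.intro) simp_all
  then show ?thesis by blast
qed

context uhf_system
begin

section \<open>Averages over the matrix subalgebras and their limit\<close>

lemma subspace: "csubspace (S n)"
  using subalgebra by (simp add: cstar_subalgebra_def)

lemma mult_in: "x \<in> S n \<Longrightarrow> y \<in> S n \<Longrightarrow> x * y \<in> S n"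
  using subalgebra by (simp add: cstar_subalgebra_def)

lemma star_in: "x \<in> S n \<Longrightarrow> star x \<in> S n"
  using subalgebra by (simp add: cstar_subalgebra_def)

lemma S_mono: "m \<le> n \<Longrightarrow> x \<in> S m \<Longrightarrow> x \<in> S n"
  using incseq by (auto simp: incseq_def)

lemma scaleC_one_inj: "c *\<^sub>C (1::'f) = d *\<^sub>C 1 \<Longrightarrow> c = d"
  using complex_vector.scale_right_imp_eq one_neq_zero by blast

lemma norm_one: "norm (1 :: 'f) = 1"
proof -
  have "(norm (1 :: 'f))\<^sup>2 = norm (1 :: 'f)" using cstar_identity[of "1 :: 'f"] by simp
  then show ?thesis using one_neq_zero by (simp add: power2_eq_square)
qed

lemma expect_mult_commute:
  assumes "y \<in> S n" shows "mu.expect n (x * y) = mu.expect n (y * x)"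
proof -
  obtain c where c: "y = (\<Sum>i<k n. \<Sum>j<k n. c i j *\<^sub>C e n i j)" using expansion[OF assms] by blast
  show ?thesis
    unfolding c sum_distrib_left sum_distrib_right mu.expect_sum mult_scaleC_left mult_scaleC_right
      mu.expect_scaleC
    by (intro sum.cong refl) (simp add: mu.expect_tracial)
qed

lemma expect_scalar:
  assumes "x \<in> S n" shows "\<exists>c. mu.expect n x = c *\<^sub>C 1"
proof -
  obtain c where c: "x = (\<Sum>i<k n. \<Sum>j<k n. c i j *\<^sub>C e n i j)" using expansion[OF assms] by blast
  show ?thesis unfolding c mu.expect_combination by blast
qed

text \<open>Moving \<open>e m j i\<close> to the front turns each summand of the average into
  \<open>e m j i * e m i j * x\<close>, and these products of units sum to k. The lemma is applied
  to later averages and to an arbitrary normalized trace.\<close>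

lemma tracial_expect:
  fixes f :: "'f \<Rightarrow> 'g::complex_vector"
  assumes lin: "\<And>x y. f (x + y) = f x + f y" "\<And>c x. f (c *\<^sub>C x) = c *\<^sub>C f x"
    and comm: "\<And>x y. y \<in> S m \<Longrightarrow> f (x * y) = f (y * x)"
  shows "f (mu.expect m x) = f x"
proof -
  have f0: "f 0 = 0" using lin(2)[of 0 0] by simp
  have f_sum: "f (\<Sum>i\<in>A. g i) = (\<Sum>i\<in>A. f (g i))" for A :: "nat set" and g
    by (induction A rule: infinite_finite_induct) (simp_all add: f0 lin)
  have "f (mu.csum m x) = (\<Sum>i<k m. \<Sum>j<k m. f (e m i j * x * e m j i))"
    by (simp add: mu.csum_def f_sum)
  also have "\<dots> = (\<Sum>i<k m. \<Sum>j<k m. f (e m j i * e m i j * x))"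
    by (intro sum.cong refl) (subst comm, simp_all add: unit_in mult.assoc)
  also have "\<dots> = f (\<Sum>i<k m. \<Sum>j<k m. e m j i * e m i j * x)"
    by (simp add: f_sum)
  also have "(\<Sum>i<k m. \<Sum>j<k m. e m j i * e m i j * x) = of_nat (k m) *\<^sub>C x"
    by (subst sum.swap) (simp add: sum_distrib_right[symmetric] mu.sum_ed mult_scaleC_left)
  finally have "f (mu.csum m x) = of_nat (k m) *\<^sub>C f x" by (simp add: lin)
  then show ?thesis using mu.k_pos[of m] by (simp add: mu.expect_def lin scaleC_scaleC)
qed

text \<open>The average at level \<open>n\<close> is tracial over \<open>S m\<close>, so it does not
  see a preceding average at level \<open>m\<close>. That one is already a scalar, which is
  fixed.\<close>

lemma expect_mono:
  assumes "m \<le> n" "x \<in> S m" shows "mu.expect n x = mu.expect m x"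
proof -
  obtain c where c: "mu.expect m x = c *\<^sub>C 1" using expect_scalar[OF assms(2)] by blast
  have "mu.expect n (mu.expect m x) = mu.expect n x"
    by (rule tracial_expect)
      (auto simp: mu.expect_add mu.expect_scaleC intro: expect_mult_commute S_mono[OF assms(1)])
  then show ?thesis by (simp add: c mu.expect_scaleC mu.expect_u)
qed

text \<open>On each \<open>S m\<close> the averages are eventually a constant scalar; density and
  closedness of the scalars extend this to F.\<close>

lemma trace_limit: "\<exists>c. (\<lambda>n. mu.expect n x) \<longlonglongrightarrow> c *\<^sub>C 1"
proof -
  have "\<exists>r\<in>range (\<lambda>c. c *\<^sub>C (1::'f)). (\<lambda>n. mu.expect n x) \<longlonglongrightarrow> r"
  proof (rule limit_in_closed[where C = 1 and D = "\<Union>n. S n"])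
    fix x assume "x \<in> (\<Union>n. S n)"
    then obtain m where m: "x \<in> S m" by blast
    obtain c where c: "mu.expect m x = c *\<^sub>C 1" using expect_scalar[OF m] by blast
    have "\<forall>\<^sub>F n in sequentially. mu.expect n x = c *\<^sub>C 1"
      using expect_mono[OF _ m] c by (auto simp: eventually_sequentially)
    then show "\<exists>r\<in>range (\<lambda>c. c *\<^sub>C (1::'f)). (\<lambda>n. mu.expect n x) \<longlonglongrightarrow> r"
      by (intro bexI[of _ "c *\<^sub>C 1"] tendsto_eventually rangeI)
  next
    show "closed (range (\<lambda>c. c *\<^sub>C (1::'f)))"
      by (rule closed_range_bounded_below[OF bounded_linear_scaleC_left, of 1])
        (simp_all add: norm_scaleC norm_one)
  qed (use mu.linear_expect mu.norm_expect_le dense in auto)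
  then show ?thesis by auto
qed

definition tr :: "'f \<Rightarrow> complex" where
  "tr x = (THE c. (\<lambda>n. mu.expect n x) \<longlonglongrightarrow> c *\<^sub>C 1)"

lemma tr_eqI: "(\<lambda>n. mu.expect n x) \<longlonglongrightarrow> c *\<^sub>C 1 \<Longrightarrow> tr x = c"
  unfolding tr_def by (rule the_equality) (auto dest: LIMSEQ_unique intro: scaleC_one_inj)

lemma tr_limit: "(\<lambda>n. mu.expect n x) \<longlonglongrightarrow> tr x *\<^sub>C 1"
  using trace_limit[of x] tr_eqI by auto

lemma tr_add: "tr (x + y) = tr x + tr y"
  by (rule tr_eqI) (simp add: mu.expect_add scaleC_add_left tendsto_add tr_limit)

lemma tr_scaleC: "tr (c *\<^sub>C x) = c * tr x"
  using tendsto_scaleC[OF tr_limit[of x], of c]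
  by (intro tr_eqI) (simp add: mu.expect_scaleC)

lemma norm_tr_le: "cmod (tr x) \<le> norm x"
proof -
  have "norm (tr x *\<^sub>C (1::'f)) \<le> norm x"
    by (rule Lim_norm_ubound[OF _ tr_limit]) (simp_all add: mu.norm_expect_le)
  then show ?thesis by (simp add: norm_scaleC norm_one)
qed

lemma bounded_linear_tr: "bounded_linear tr"
  by (rule bounded_linear_intro[of _ 1])
    (simp_all add: tr_add norm_tr_le scaleC_of_real[symmetric] tr_scaleC scaleR_conv_of_real)

lemma tr_zero [simp]: "tr 0 = 0"
  by (rule linear_0[OF bounded_linear.linear[OF bounded_linear_tr]])

lemma tr_diff: "tr (x - y) = tr x - tr y"
  by (rule linear_diff[OF bounded_linear.linear[OF bounded_linear_tr]])

lemma tr_sum: "tr (\<Sum>i\<in>A. f i) = (\<Sum>i\<in>A. tr (f i))"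
  by (rule linear_sum[OF bounded_linear.linear[OF bounded_linear_tr]])

lemma tr_one: "tr 1 = 1"
  by (rule tr_eqI) (simp add: mu.expect_u)

lemma expect_tr: "x \<in> S n \<Longrightarrow> mu.expect n x = tr x *\<^sub>C 1"
proof -
  assume x: "x \<in> S n"
  obtain c where c: "mu.expect n x = c *\<^sub>C 1" using expect_scalar[OF x] by blast
  have "\<forall>\<^sub>F m in sequentially. mu.expect m x = c *\<^sub>C 1"
    using expect_mono[OF _ x] c by (auto simp: eventually_sequentially)
  then have "tr x = c" by (intro tr_eqI tendsto_eventually)
  then show ?thesis using c by simp
qed

lemma dense_induct:
  assumes "closed {x. P x}" "\<And>n x. x \<in> S n \<Longrightarrow> P x"
  shows "P x"
proof -
  have "closure (\<Union>n. S n) \<subseteq> {x. P x}" by (rule closure_minimal) (use assms in auto)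
  then show ?thesis using dense by auto
qed

lemma continuous_tr: "continuous_on UNIV f \<Longrightarrow> continuous_on UNIV (\<lambda>x. tr (f x))"
  by (rule bounded_linear.continuous_on[OF bounded_linear_tr])

lemma continuous_star: "continuous_on UNIV f \<Longrightarrow> continuous_on UNIV (\<lambda>x. star (f x :: 'f))"
  by (rule bounded_linear.continuous_on[OF bounded_linear_star])

text \<open>From the level of \<open>y\<close> on, the averages of both products agree; continuity
  in \<open>y\<close> and density finish the argument.\<close>

lemma tr_commute: "tr (x * y) = tr (y * x)"
proof (rule dense_induct[of "\<lambda>y. tr (x * y) = tr (y * x)"])
  show "closed {y. tr (x * y) = tr (y * x)}"
    by (intro closed_Collect_eq continuous_tr continuous_intros)
next
  fix m y assume y: "y \<in> S m"
  have "\<forall>\<^sub>F n in sequentially. mu.expect n (y * x) = mu.expect n (x * y)"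
    by (rule eventually_sequentiallyI[of m], rule expect_mult_commute[OF S_mono[OF _ y], symmetric])
  with tr_limit[of "y * x"] have "(\<lambda>n. mu.expect n (x * y)) \<longlonglongrightarrow> tr (y * x) *\<^sub>C 1"
    by (rule Lim_transform_eventually)
  then show "tr (x * y) = tr (y * x)" by (rule tr_eqI)
qed

lemma tr_unit:
  assumes "p < k n" "q < k n"
  shows "tr (e n p q) = (if p = q then inverse (of_nat (k n)) else 0)"
proof (rule scaleC_one_inj)
  show "tr (e n p q) *\<^sub>C 1 = (if p = q then inverse (of_nat (k n)) else 0) *\<^sub>C (1::'f)"
    unfolding expect_tr[OF unit_in[OF assms], symmetric] using assms by (simp add: mu.expect_unit)
qed

text \<open>Up to the factor k, the units \<open>e n j i\<close> form the dual basis of the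
  \<open>e n i j\<close> under the trace pairing.\<close>

lemma tr_entry:
  assumes "i < k n" "j < k n"
  shows "tr (e n j i * (\<Sum>p<k n. \<Sum>q<k n. c p q *\<^sub>C e n p q)) = c i j * inverse (of_nat (k n))"
proof -
  have "tr (e n j i * (\<Sum>p<k n. \<Sum>q<k n. c p q *\<^sub>C e n p q)) =
      (\<Sum>p<k n. \<Sum>q<k n. if q = j then if p = i then c i j * inverse (of_nat (k n)) else 0 else 0)"
    unfolding sum_distrib_left tr_sum mult_scaleC_right tr_scaleC
    using assms by (intro sum.cong refl) (simp add: mu.unit_mult tr_unit)
  then show ?thesis using assms by (simp add: sum.delta)
qed

text \<open>Expanding \<open>star x\<close> and reading off the coefficients by
  \<open>tr_entry\<close> gives 1/k times the sum of the squared moduli of the entries.\<close>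

lemma tr_star_mult_in:
  assumes "x \<in> S n" shows "tr (star x * x) \<in> \<real>\<^sub>\<ge>\<^sub>0"
proof -
  obtain c where c: "x = (\<Sum>i<k n. \<Sum>j<k n. c i j *\<^sub>C e n i j)" using expansion[OF assms] by blast
  have entry: "tr (star (e n i j) * x) = c i j * inverse (of_nat (k n))" if "i < k n" "j < k n" for i j
    using that by (simp add: c mu.star_unit tr_entry)
  have "tr (star x * x) = (\<Sum>i<k n. \<Sum>j<k n. cnj (c i j) * tr (star (e n i j) * x))"
    by (subst c) (simp add: star_sum star_scaleC sum_distrib_right tr_sum mult_scaleC_left tr_scaleC)
  also have "\<dots> = (\<Sum>i<k n. \<Sum>j<k n. of_real ((cmod (c i j))\<^sup>2 * inverse (real (k n))))"
  proof (intro sum.cong refl)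
    fix i j assume "i \<in> {..<k n}" "j \<in> {..<k n}"
    then have "cnj (c i j) * tr (star (e n i j) * x) = (c i j * cnj (c i j)) * inverse (of_nat (k n))"
      by (simp add: entry)
    also have "\<dots> = of_real ((cmod (c i j))\<^sup>2 * inverse (real (k n)))"
      unfolding complex_norm_square[symmetric] by simp
    finally show "cnj (c i j) * tr (star (e n i j) * x) =
        of_real ((cmod (c i j))\<^sup>2 * inverse (real (k n)))" .
  qed
  also have "\<dots> = of_real (\<Sum>i<k n. \<Sum>j<k n. (cmod (c i j))\<^sup>2 * inverse (real (k n)))"
    by (simp only: of_real_sum)
  finally show ?thesis
    by (simp only: nonneg_Reals_of_real_iff) (intro sum_nonneg mult_nonneg_nonneg; simp)
qed

lemma tr_star_mult: "tr (star x * x) \<in> \<real>\<^sub>\<ge>\<^sub>0"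
proof (rule dense_induct[of "\<lambda>x. tr (star x * x) \<in> \<real>\<^sub>\<ge>\<^sub>0"])
  show "closed {x. tr (star x * x) \<in> \<real>\<^sub>\<ge>\<^sub>0}"
  proof -
    have "continuous_on UNIV (\<lambda>x. tr (star x * x))"
      by (intro continuous_tr continuous_star continuous_intros)
    from continuous_closed_preimage[OF this closed_UNIV closed_nonneg_Reals_complex]
    show ?thesis by (simp add: vimage_def)
  qed
qed (rule tr_star_mult_in)

lemma normalized_trace_tr: "normalized_trace tr"
proof -
  have "tr (star x * x) \<in> \<real> \<and> Re (tr (star x * x)) \<ge> 0" for x
    using tr_star_mult[of x] by (simp add: complex_nonneg_Reals_iff complex_is_Real_iff)
  then show ?thesis
    unfolding normalized_trace_def using bounded_linear_tr tr_scaleC tr_one tr_commute by blast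
qed

lemma normalized_trace_unique:
  assumes \<sigma>: "normalized_trace \<sigma>" shows "\<sigma> = tr"
proof
  fix x
  have bl: "bounded_linear \<sigma>" using \<sigma> by (simp add: normalized_trace_def)
  have scale: "\<sigma> (c *\<^sub>C x) = c * \<sigma> x" and one: "\<sigma> 1 = 1" for c x
    using \<sigma> by (simp_all add: normalized_trace_def)
  show "\<sigma> x = tr x"
  proof (rule dense_induct[of "\<lambda>x. \<sigma> x = tr x"])
    show "closed {x. \<sigma> x = tr x}"
      by (intro closed_Collect_eq continuous_tr bounded_linear.continuous_on[OF bl] continuous_intros)
  next
    fix n x assume x: "x \<in> S n"
    \<comment> \<open>The values of \<sigma> are carried into F as multiples of 1, because
      \<open>tracial_expect\<close> is about maps into a \<open>complex_vector\<close> type.\<close>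
    have "\<sigma> (mu.expect n x) *\<^sub>C (1::'f) = \<sigma> x *\<^sub>C 1"
      using \<sigma> by (intro tracial_expect[of "\<lambda>x. \<sigma> x *\<^sub>C (1::'f)"])
        (simp_all add: normalized_trace_def linear_simps(1)[OF bl] scaleC_add_left scaleC_scaleC)
    then show "\<sigma> x = tr x"
      using one_neq_zero by (simp add: expect_tr[OF x] scale one)
  qed
qed

lemma the_trace_eq: "the_trace = tr"
  unfolding the_trace_def
  by (rule the_equality) (rule normalized_trace_tr, rule normalized_trace_unique)

end

section \<open>Contractive projections onto the matrix subalgebras\<close>

lemma star_power: "star (x ^ n) = star x ^ n" for x :: "'f::unital_cstar_algebra"
  by (induction n) (simp_all add: star_mult power_commutes)

text \<open>The C*-identity gives the norm of a square of a selfadjoint element, and repeated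
  squaring reaches the exponents 2^j.\<close>

lemma norm_power_selfadjoint:
  fixes h :: "'f::unital_cstar_algebra"
  assumes "star h = h" shows "norm (h ^ (2 ^ j)) = norm h ^ (2 ^ j)"
proof (induction j)
  case (Suc j)
  have "h ^ (2 ^ Suc j) = star (h ^ (2 ^ j)) * h ^ (2 ^ j)"
    by (simp add: star_power assms power_add[symmetric] mult_2)
  then have "norm (h ^ (2 ^ Suc j)) = (norm (h ^ (2 ^ j)))\<^sup>2" by (simp only: cstar_identity)
  also have "\<dots> = norm h ^ (2 ^ Suc j)" by (simp add: Suc power_mult[symmetric] mult.commute)
  finally show ?case .
qed simp

lemma norm_power_le: "norm (h ^ m) \<le> norm h ^ m" for h :: "'f::unital_cstar_algebra"
proof (induction m)
  case (Suc m)
  have "norm (h ^ Suc m) \<le> norm h * norm (h ^ m)" by (simp add: norm_mult_ineq)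
  also have "\<dots> \<le> norm h * norm h ^ m" by (intro mult_left_mono Suc norm_ge_zero)
  finally show ?case by simp
qed (simp add: norm_one_cstar)

section \<open>The inner product given by the trace\<close>

context uhf_system
begin

text \<open>The squared norm of the GNS inner product \<open>tr (star a * b)\<close>.\<close>

definition sq :: "'f \<Rightarrow> real" where "sq x = Re (tr (star x * x))"

lemma sq_nonneg: "sq x \<ge> 0"
  using tr_star_mult[of x] by (simp add: sq_def complex_nonneg_Reals_iff)

lemma tr_sq: "tr (star x * x) = of_real (sq x)"
  using tr_star_mult[of x] by (simp add: sq_def complex_nonneg_Reals_iff complex_eq_iff)

lemma sq_star: "sq (star x) = sq x"
  by (simp add: sq_def star_star tr_commute[of x])

lemma sq_le: "sq x \<le> (norm x)\<^sup>2"
proof -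
  have "sq x \<le> cmod (tr (star x * x))" by (simp add: sq_def complex_Re_le_cmod)
  also have "\<dots> \<le> norm (star x * x)" by (rule norm_tr_le)
  finally show ?thesis by (simp add: cstar_identity)
qed

text \<open>Polarization: the trace is real on \<open>star y * y\<close> for y = 1 + x and for y = 1
  + \<i> x, which compares the imaginary and the real parts.\<close>

lemma tr_star: "tr (star x) = cnj (tr x)"
proof -
  have im: "Im (tr (star y * y)) = 0" for y by (simp add: tr_sq)
  have "star (1 + x) * (1 + x) = 1 + x + star x + star x * x"
    by (simp add: star_add algebra_simps)
  with im[of "1 + x"] im[of x] have 1: "Im (tr x) + Im (tr (star x)) = 0"
    by (simp add: tr_add tr_one)
  have "star (1 + \<i> *\<^sub>C x) * (1 + \<i> *\<^sub>C x) = 1 + \<i> *\<^sub>C x + (- \<i>) *\<^sub>C star x + star x * x"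
    by (simp add: star_add star_scaleC algebra_simps mult_scaleC_left mult_scaleC_right)
  with im[of "1 + \<i> *\<^sub>C x"] im[of x] have 2: "Re (tr x) - Re (tr (star x)) = 0"
    by (simp only: tr_add tr_one tr_scaleC) simp
  show ?thesis using 1 2 by (simp add: complex_eq_iff)
qed

lemma tr_Cauchy_Schwarz: "(cmod (tr (star a * b)))\<^sup>2 \<le> sq a * sq b"
proof -
  define z where "z = tr (star a * b)"
  have z': "tr (star b * a) = cnj z"
    by (simp add: z_def tr_star[symmetric] star_mult star_star)
  have quad: "0 \<le> sq b - 2 * s * (cmod z)\<^sup>2 + s\<^sup>2 * (cmod z)\<^sup>2 * sq a" for s :: real
  proof -
    \<comment> \<open>A real multiple of \<open>z\<close> gives a quadratic polynomial in
      \<open>s\<close> with real coefficients.\<close>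
    define l where "l = of_real s * z"
    have "star (b - l *\<^sub>C a) * (b - l *\<^sub>C a) =
        star b * b - l *\<^sub>C (star b * a) - cnj l *\<^sub>C (star a * b) + (cnj l * l) *\<^sub>C (star a * a)"
      by (simp add: star_diff star_scaleC mult_scaleC_left mult_scaleC_right algebra_simps
        complex_vector.scale_right_diff_distrib)
    then have "tr (star (b - l *\<^sub>C a) * (b - l *\<^sub>C a)) =
        of_real (sq b) - l * cnj z - cnj l * z + cnj l * l * of_real (sq a)"
      by (simp only: tr_add tr_diff tr_scaleC tr_sq z' z_def[symmetric])
    also have "\<dots> = of_real (sq b) - 2 * of_real s * (z * cnj z) + (of_real s)\<^sup>2 * (z * cnj z) * of_real (sq a)"
      by (simp add: l_def power2_eq_square algebra_simps)
    also have "\<dots> = of_real (sq b - 2 * s * (cmod z)\<^sup>2 + s\<^sup>2 * (cmod z)\<^sup>2 * sq a)"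
      by (simp only: complex_norm_square[symmetric] of_real_add of_real_diff of_real_mult of_real_power of_real_numeral)
    finally have "sq (b - l *\<^sub>C a) = sq b - 2 * s * (cmod z)\<^sup>2 + s\<^sup>2 * (cmod z)\<^sup>2 * sq a"
      by (simp only: tr_sq of_real_eq_iff)
    then show ?thesis using sq_nonneg[of "b - l *\<^sub>C a"] by simp
  qed
  have "(cmod z)\<^sup>2 \<le> sq a * sq b"
  proof (cases "sq a = 0")
    case True
    have "cmod z = 0"
    proof (rule ccontr)
      assume "cmod z \<noteq> 0"
      \<comment> \<open>For this \<open>s\<close> the quadratic expression equals -1.\<close>
      then show False using quad[of "(sq b + 1) / (2 * (cmod z)\<^sup>2)"] True by simp
    qed
    then show ?thesis using True by simp
  next
    case False
    then have "sq a > 0" using sq_nonneg[of a] by simp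
    \<comment> \<open>The value 1 / sq a minimises the quadratic expression.\<close>
    then show ?thesis using quad[of "1 / sq a"] by (simp add: power2_eq_square field_simps)
  qed
  then show ?thesis by (simp add: z_def)
qed

text \<open>Iterating the Cauchy-Schwarz inequality along the powers \<open>h ^ 2 ^ j\<close> of \<open>h = star w * w\<close>
  replaces the functional calculus that usually gives \<open>h \<le> \<parallel>h\<parallel>\<close>.\<close>

lemma sq_mult_le: "sq (w * g) \<le> (norm w)\<^sup>2 * sq g"
proof -
  define h where "h = star w * w"
  have h: "star h = h" by (simp add: h_def star_mult star_star)
  \<comment> \<open>Moments of \<open>h\<close> against the vector \<open>g\<close>. The claim is
    about \<open>p 1\<close>, and Cauchy-Schwarz for \<open>g\<close> and \<open>h ^ m * g\<close>
    relates \<open>p m\<close> to \<open>p (2 * m)\<close>.\<close>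
  define p where "p m = Re (tr (star g * (h ^ m * g)))" for m
  have p1: "p 1 = sq (w * g)" by (simp add: p_def sq_def h_def star_mult mult.assoc)
  then have p1_nonneg: "p 1 \<ge> 0" by (simp only: sq_nonneg)
  have p_le: "(p m)\<^sup>2 \<le> sq g * p (2 * m)" for m
  proof -
    have "sq (h ^ m * g) = p (2 * m)"
      by (simp add: sq_def p_def star_mult star_power h mult.assoc mult_2 power_add)
    moreover have "\<bar>p m\<bar> \<le> cmod (tr (star g * (h ^ m * g)))"
      by (simp add: p_def abs_Re_le_cmod)
    ultimately show ?thesis
      using tr_Cauchy_Schwarz[of g "h ^ m * g"] by (metis abs_le_square_iff abs_norm_cancel order_trans)
  qed
  have p_bound: "p m \<le> (norm g)\<^sup>2 * norm h ^ m" for m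
  proof -
    have "p m \<le> norm (star g * (h ^ m * g))"
      unfolding p_def using complex_Re_le_cmod norm_tr_le order_trans by blast
    also have "\<dots> \<le> norm g * (norm (h ^ m) * norm g)"
      by (rule order_trans[OF norm_mult_ineq]) (simp add: norm_star mult_left_mono norm_mult_ineq)
    also have "\<dots> \<le> norm g * (norm h ^ m * norm g)"
      by (intro mult_left_mono mult_right_mono norm_power_le norm_ge_zero)
    finally show ?thesis by (simp add: power2_eq_square algebra_simps)
  qed
  have "p 1 \<le> norm h * sq g"
  proof (cases "sq g = 0 \<or> norm h = 0")
    case True
    then show ?thesis
    proof
      assume "sq g = 0"
      then show ?thesis using p_le[of 1] by simp
    next
      assume "norm h = 0"
      then show ?thesis using p_bound[of 1] by simp
    qed
  next
    case False
    then have pos: "sq g > 0" "norm h > 0" using sq_nonneg[of g] by auto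
    \<comment> \<open>Repeated use of \<open>p_le\<close> from m = 1; the factor \<open>sq g\<close>
      on the left avoids the exponent 2^j - 1 on the right.\<close>
    have iter: "sq g * p 1 ^ (2 ^ j) \<le> sq g ^ (2 ^ j) * p (2 ^ j)" for j
    proof (induction j)
      case (Suc j)
      have "(sq g * p 1 ^ (2 ^ j))\<^sup>2 \<le> (sq g ^ (2 ^ j) * p (2 ^ j))\<^sup>2"
        by (rule power_mono[OF Suc]) (intro mult_nonneg_nonneg zero_le_power sq_nonneg p1_nonneg)
      also have "\<dots> = (sq g ^ (2 ^ j))\<^sup>2 * (p (2 ^ j))\<^sup>2" by (simp add: power_mult_distrib)
      also have "\<dots> \<le> (sq g ^ (2 ^ j))\<^sup>2 * (sq g * p (2 * 2 ^ j))"
        by (intro mult_left_mono p_le) simp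
      also have "\<dots> = sq g * (sq g ^ (2 ^ Suc j) * p (2 ^ Suc j))"
        by (simp add: power_mult[symmetric] mult.commute)
      finally have "sq g * (sq g * p 1 ^ (2 ^ Suc j)) \<le> sq g * (sq g ^ (2 ^ Suc j) * p (2 ^ Suc j))"
        by (simp add: power_mult_distrib power_mult[symmetric] power2_eq_square[of "sq g"] mult_ac)
      then show ?case using pos by simp
    qed simp
    \<comment> \<open>The crude bound on \<open>p (2 ^ j)\<close> costs only the constant
      \<open>(norm g)\<^sup>2 / sq g\<close>, which does not depend on j.\<close>
    have "p 1 / (norm h * sq g) \<le> 1"
    proof (rule le_one_if_powers_bounded[where C = "(norm g)\<^sup>2 / sq g"])
      show "p 1 / (norm h * sq g) \<ge> 0" 
        by (intro divide_nonneg_nonneg mult_nonneg_nonneg p1_nonneg sq_nonneg norm_ge_zero)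
      fix j
      have "sq g * p 1 ^ (2 ^ j) \<le> sq g ^ (2 ^ j) * ((norm g)\<^sup>2 * norm h ^ (2 ^ j))"
        by (rule order_trans[OF iter mult_left_mono[OF p_bound]]) (simp add: sq_nonneg)
      then show "(p 1 / (norm h * sq g)) ^ (2 ^ j) \<le> (norm g)\<^sup>2 / sq g"
        using pos by (simp add: power_divide power_mult_distrib field_simps)
    qed
    then show ?thesis using pos by (simp add: field_simps)
  qed
  then show ?thesis unfolding p1 by (simp add: h_def cstar_identity)
qed

text \<open>The trace preserving conditional expectation onto \<open>S n\<close>, that is, the
  orthogonal projection for the trace inner product. The factor k compensates for the trace 1/k of
  \<open>e n i j * e n j i\<close>.\<close>

definition proj :: "nat \<Rightarrow> 'f \<Rightarrow> 'f" where
  "proj n x = (\<Sum>i<k n. \<Sum>j<k n. (of_nat (k n) * tr (x * e n j i)) *\<^sub>C e n i j)"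

lemma proj_in: "proj n x \<in> S n"
  unfolding proj_def
  by (intro complex_vector.subspace_sum complex_vector.subspace_scale subspace unit_in) auto

lemma proj_id: assumes "x \<in> S n" shows "proj n x = x"
proof -
  obtain c where c: "x = (\<Sum>i<k n. \<Sum>j<k n. c i j *\<^sub>C e n i j)" using expansion[OF assms] by blast
  have "of_nat (k n) * tr (x * e n j i) = c i j" if "i < k n" "j < k n" for i j
    using mu.k_pos[of n] tr_entry[OF that, of c] by (simp add: c[symmetric] tr_commute[of x])
  then have "proj n x = (\<Sum>i<k n. \<Sum>j<k n. c i j *\<^sub>C e n i j)"
    unfolding proj_def by (intro sum.cong refl) simp
  then show ?thesis using c by simp
qed

lemma tr_proj: assumes "y \<in> S n" shows "tr (y * proj n x) = tr (y * x)"
proof -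
  obtain c where c: "y = (\<Sum>i<k n. \<Sum>j<k n. c i j *\<^sub>C e n i j)" using expansion[OF assms] by blast
  have unit: "tr (e n i j * proj n x) = tr (e n i j * x)" if "i < k n" "j < k n" for i j
    unfolding proj_def tr_entry[OF that(2,1)] using mu.k_pos[of n] by (simp add: tr_commute[of x])
  show ?thesis
    unfolding c sum_distrib_right tr_sum mult_scaleC_left tr_scaleC
    by (intro sum.cong refl) (simp add: unit)
qed

text \<open>There are k^2 matrix entries, each with coefficient at most k times the square root of
  \<open>sq y\<close>. The constant is crude, but it only has to stay fixed while powers of one
  element are taken.\<close>

lemma norm_le_sq:
  assumes "y \<in> S n" shows "norm y \<le> real (k n) ^ 3 * sqrt (sq y)"
proof -
  have "norm (proj n y) \<le> (\<Sum>i<k n. \<Sum>j<k n. real (k n) * sqrt (sq y))"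
    unfolding proj_def
  proof (intro sum_norm_le)
    fix i j assume ij: "i \<in> {..<k n}" "j \<in> {..<k n}"
    have ne: "norm (e n i j) \<le> 1" if "i < k n" "j < k n" for i j
      using that by (rule mu.norm_unit_le)
    have "(cmod (tr (y * e n j i)))\<^sup>2 \<le> sq y * sq (e n j i)"
      using tr_Cauchy_Schwarz[of "star y" "e n j i"] by (simp add: star_star sq_star)
    also have "\<dots> \<le> sq y * 1"
      using ne[of j i] ij by (intro mult_left_mono sq_nonneg order_trans[OF sq_le]) (simp_all add: power_le_one)
    finally have "cmod (tr (y * e n j i)) \<le> sqrt (sq y)" by (simp add: real_le_rsqrt)
    then have "cmod (tr (y * e n j i)) * norm (e n i j) \<le> sqrt (sq y) * 1"
      using ne[of i j] ij by (intro mult_mono) (simp_all add: sq_nonneg)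
    then show "norm ((of_nat (k n) * tr (y * e n j i)) *\<^sub>C e n i j) \<le> real (k n) * sqrt (sq y)"
      by (simp add: norm_scaleC norm_mult mult.assoc mult_left_mono)
  qed
  then show ?thesis by (simp add: proj_id[OF assms] power3_eq_cube mult.assoc)
qed

text \<open>For \<open>h = star z * z\<close> with \<open>z = proj n x\<close>, the Cauchy-Schwarz inequality gives
  \<open>tr (h ^ Suc m) \<le> \<parallel>x\<parallel>\<^sup>2 * tr (h ^ m)\<close>, and these moments control \<open>\<parallel>h\<parallel>\<close>.\<close>

lemma norm_proj_le: "norm (proj n x) \<le> norm x"
proof (cases "x = 0")
  case True
  then show ?thesis by (simp add: proj_def)
next
  case False
  define z where "z = proj n x"
  define h where "h = star z * z"
  define s where "s m = Re (tr (h ^ m))" for m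
  have h: "star h = h" by (simp add: h_def star_mult star_star)
  have zS: "z \<in> S n" by (simp add: z_def proj_in)
  then have hS: "h \<in> S n" by (simp add: h_def mult_in star_in)
  have hpS: "h ^ m \<in> S n" for m by (induction m) (simp_all add: one_in hS mult_in)
  have hp: "star (h ^ m) = h ^ m" for m by (simp add: star_power h)
  have sq_h: "sq (h ^ m) = s (2 * m)" for m
    by (simp add: sq_def hp s_def mult_2 power_add)
  have sq_zh: "sq (z * h ^ m) = s (2 * m + 1)" for m
  proof -
    have "star (z * h ^ m) * (z * h ^ m) = star (h ^ m) * (star z * z) * h ^ m"
      by (simp only: star_mult mult.assoc)
    also have "\<dots> = h ^ m * h * h ^ m" by (simp only: hp h_def[symmetric])
    also have "\<dots> = h ^ (2 * m + 1)" by (simp add: power_add mult_2 power_commutes mult.assoc)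
    finally show ?thesis by (simp only: sq_def s_def)
  qed
  \<comment> \<open>Even moments are values of \<open>sq\<close> at powers of \<open>h\<close>, odd
    ones at \<open>z\<close> times such powers.\<close>
  have s_nonneg: "s m \<ge> 0" for m
    using sq_nonneg[of "h ^ (m div 2)"] sq_nonneg[of "z * h ^ (m div 2)"]
    unfolding sq_h sq_zh by (cases "even m") (auto elim!: evenE oddE)
  have sq_x: "sq (h ^ m * star z * x) \<le> (norm x)\<^sup>2 * s (2 * m + 1)" for m
  proof -
    have "sq (h ^ m * star z * x) = sq (star x * (z * h ^ m))"
      by (subst sq_star[symmetric]) (simp add: star_mult star_star hp mult.assoc)
    also have "\<dots> \<le> (norm (star x))\<^sup>2 * sq (z * h ^ m)" by (rule sq_mult_le)
    finally show ?thesis by (simp only: norm_star sq_zh)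
  qed
  have CS: "(s (a + m + 1))\<^sup>2 \<le> s (2 * a) * ((norm x)\<^sup>2 * s (2 * m + 1))" for a m
  proof -
    \<comment> \<open>The last factor \<open>h\<close> is split as \<open>star z * z\<close>. What
      precedes \<open>z\<close> lies in \<open>S n\<close>, so \<open>tr_proj\<close> replaces
      \<open>z\<close> by \<open>x\<close>.\<close>
    have "tr (h ^ (a + m + 1)) = tr ((h ^ (a + m) * star z) * proj n x)"
      by (simp add: power_commutes h_def z_def mult.assoc flip: power_Suc2)
    also have "\<dots> = tr ((h ^ (a + m) * star z) * x)"
      by (rule tr_proj) (intro mult_in hpS star_in zS)
    also have "\<dots> = tr (star (h ^ a) * (h ^ m * star z * x))"
      by (simp add: hp power_add mult.assoc)
    finally have eq: "tr (h ^ (a + m + 1)) = tr (star (h ^ a) * (h ^ m * star z * x))" .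
    have "(s (a + m + 1))\<^sup>2 \<le> (cmod (tr (star (h ^ a) * (h ^ m * star z * x))))\<^sup>2"
      unfolding s_def eq by (metis abs_Re_le_cmod abs_le_square_iff abs_norm_cancel)
    also have "\<dots> \<le> sq (h ^ a) * sq (h ^ m * star z * x)" by (rule tr_Cauchy_Schwarz)
    also have "\<dots> \<le> s (2 * a) * ((norm x)\<^sup>2 * s (2 * m + 1))"
      unfolding sq_h by (intro mult_left_mono sq_x s_nonneg)
    finally show ?thesis .
  qed
  have step: "s (Suc m) \<le> (norm x)\<^sup>2 * s m" for m
  proof -
    \<comment> \<open>The parity of \<open>m\<close> decides how the exponent is split in
      \<open>CS\<close>, so that one factor on the right is again \<open>s (Suc m)\<close> and can
      be cancelled.\<close>
    have "s (Suc m) * s (Suc m) \<le> s (Suc m) * ((norm x)\<^sup>2 * s m)"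
    proof (cases "even m")
      case True
      then obtain q where "m = 2 * q" by blast
      then have "q + q + 1 = Suc m" "2 * q + 1 = Suc m" "2 * q = m" by simp_all
      with CS[of q q] show ?thesis by (simp only: power2_eq_square mult_ac)
    next
      case False
      then obtain q where "m = 2 * q + 1" by (elim oddE)
      then have "q + 1 + q + 1 = Suc m" "2 * (q + 1) = Suc m" "2 * q + 1 = m" by simp_all
      with CS[of "q + 1" q] show ?thesis by (simp only: power2_eq_square)
    qed
    then show ?thesis
      using s_nonneg[of "Suc m"] s_nonneg[of m] by (cases "s (Suc m) = 0") simp_all
  qed
  have s_le: "s m \<le> (norm x ^ m)\<^sup>2" for m
  proof (induction m)
    case (Suc m)
    have "s (Suc m) \<le> (norm x)\<^sup>2 * (norm x ^ m)\<^sup>2"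
      by (rule order_trans[OF step mult_left_mono[OF Suc]]) simp
    then show ?case by (simp add: power_mult_distrib)
  qed (simp add: s_def tr_one)
  \<comment> \<open>The constant k^3 from \<open>norm_le_sq\<close> is independent of the power of
    \<open>h\<close> and disappears.\<close>
  have "norm h / (norm x)\<^sup>2 \<le> 1"
  proof (rule le_one_if_powers_bounded)
    fix j
    have "norm h ^ (2 ^ j) = norm (h ^ (2 ^ j))" by (simp add: norm_power_selfadjoint h)
    also have "\<dots> \<le> real (k n) ^ 3 * sqrt (s (2 * 2 ^ j))"
      using norm_le_sq[OF hpS] by (simp add: sq_h)
    also have "\<dots> \<le> real (k n) ^ 3 * sqrt ((norm x ^ (2 * 2 ^ j))\<^sup>2)"
      by (intro mult_left_mono real_sqrt_le_mono s_le) simp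
    also have "\<dots> = real (k n) ^ 3 * ((norm x)\<^sup>2) ^ (2 ^ j)" by (simp add: power_mult)
    finally show "(norm h / (norm x)\<^sup>2) ^ (2 ^ j) \<le> real (k n) ^ 3"
      using False by (simp add: power_divide field_simps)
  qed simp
  then have "(norm z)\<^sup>2 \<le> (norm x)\<^sup>2"
    using False by (simp add: h_def cstar_identity field_simps)
  then show ?thesis by (simp add: z_def)
qed

text \<open>Commutators of off-diagonal units supply the differences of diagonal units, and together
  these span the traceless matrices.\<close>

lemma trace_zero_induct:
  assumes V: "csubspace V"
    and offdiag: "\<And>i j. \<lbrakk>i < k n; j < k n; i \<noteq> j\<rbrakk> \<Longrightarrow> e n i j \<in> V"
    and ad: "\<And>i j v. \<lbrakk>i < k n; j < k n; v \<in> V\<rbrakk> \<Longrightarrow> e n i j * v - v * e n i j \<in> V"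
    and x: "x \<in> S n" "tr x = 0"
  shows "x \<in> V"
proof -
  obtain c where c: "x = (\<Sum>i<k n. \<Sum>j<k n. c i j *\<^sub>C e n i j)" using expansion[OF x(1)] by blast
  have "(inverse (of_nat (k n)) * (\<Sum>i<k n. c i i)) *\<^sub>C (1::'f) = 0"
    using expect_tr[OF x(1)] x(2) unfolding c mu.expect_combination by simp
  then have c0: "(\<Sum>i<k n. c i i) = 0" using one_neq_zero mu.k_pos[of n] by simp
  have diag: "e n i i - e n 0 0 \<in> V" if "i < k n" for i
  proof (cases "i = 0")
    case True
    then show ?thesis using complex_vector.subspace_0[OF V] by simp
  next
    case False
    then show ?thesis using ad[of i 0 "e n 0 i"] offdiag[of 0 i] that by (simp add: mu.unit_mult)
  qed
  \<comment> \<open>Each diagonal unit is replaced by its difference with \<open>e n 0 0\<close>;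
    the total correction has coefficient 0 because the trace vanishes.\<close>
  have "x = (\<Sum>i<k n. \<Sum>j<k n. (if i = j then c i i *\<^sub>C (e n i i - e n 0 0) else c i j *\<^sub>C e n i j) +
      (if i = j then c i i *\<^sub>C e n 0 0 else 0))"
    unfolding c by (intro sum.cong refl) (auto simp: complex_vector.scale_right_diff_distrib)
  also have "\<dots> = (\<Sum>i<k n. \<Sum>j<k n. if i = j then c i i *\<^sub>C (e n i i - e n 0 0) else c i j *\<^sub>C e n i j) +
      (\<Sum>i<k n. c i i) *\<^sub>C e n 0 0"
    by (simp add: sum.distrib complex_vector.scale_sum_left)
  also have "\<dots> \<in> V"
    unfolding c0
    by (intro complex_vector.subspace_add complex_vector.subspace_sum V)
      (auto intro!: complex_vector.subspace_scale[OF V] diag offdiag simp: complex_vector.subspace_0[OF V])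
  finally show ?thesis .
qed

lemma proj_add: "proj n (x + y) = proj n x + proj n y"
  by (simp add: proj_def distrib_left distrib_right tr_add scaleC_add_left sum.distrib)

lemma proj_scaleC: "proj n (c *\<^sub>C x) = c *\<^sub>C proj n x"
  by (simp add: proj_def mult_scaleC_left tr_scaleC sum_scaleC_right mult_ac)

lemma proj_limit: "(\<lambda>n. proj n x) \<longlonglongrightarrow> x"
proof (rule tendsto_of_dense[where T = proj and T' = "\<lambda>x. x" and C = 1 and C' = 1, OF _ _ _ _ _ dense])
  show "linear (proj n)" for n
    by (rule linearI) (simp_all add: proj_add proj_scaleC scaleC_of_real[symmetric])
  show "linear (\<lambda>x :: 'f. x)" by (rule linearI) auto
  fix x assume "x \<in> (\<Union>n. S n)"
  then obtain m where "x \<in> S m" by blast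
  then have "\<forall>\<^sub>F n in sequentially. proj n x = x"
    using S_mono proj_id by (intro eventually_sequentiallyI[of m]) blast
  then show "(\<lambda>n. proj n x) \<longlonglongrightarrow> x" by (rule tendsto_eventually)
qed (simp_all add: norm_proj_le)

end

section \<open>The projective tensor product with a UHF algebra\<close>

lemma sum_list_sum_swap:
  "(\<Sum>x\<leftarrow>xs. \<Sum>v\<in>B. g x v) = (\<Sum>v\<in>B. \<Sum>x\<leftarrow>xs. (g x v :: 'a::comm_monoid_add))"
  by (induction xs) (simp_all add: sum.distrib)

context projective_tensor_product
begin

abbreviation algebraic :: "'a set" where
  "algebraic \<equiv> cspan {t b x | b x. True}"

lemma t_scaleR: "t (r *\<^sub>R b) x = r *\<^sub>R t b x" "t b (r *\<^sub>R x) = r *\<^sub>R t b x"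
  by (simp_all only: scaleC_of_real[symmetric] tensor_scaleC)

lemma linear_t_left: "linear (\<lambda>b. t b x)"
  by (rule linearI) (simp_all add: tensor_add t_scaleR)

lemma linear_t_right: "linear (\<lambda>x. t b x)"
  by (rule linearI) (simp_all add: tensor_add t_scaleR)

lemmas t_zero = linear_0[OF linear_t_left] linear_0[OF linear_t_right]
lemmas t_diff = linear_diff[OF linear_t_left] linear_diff[OF linear_t_right]
lemmas t_sum = linear_sum[OF linear_t_left] linear_sum[OF linear_t_right]

lemma t_in_algebraic: "t b x \<in> algebraic"
  by (rule complex_vector.span_base) blast

lemma algebraic_induct:
  assumes "u \<in> algebraic" "csubspace {u. P u}" "\<And>b x. P (t b x)"
  shows "P u"
  using complex_vector.span_induct[OF assms(1,2)] assms(3) by blast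

lemma tensor_induct:
  assumes "csubspace {u. P u}" "closed {u. P u}" "\<And>b x. P (t b x)"
  shows "P u"
proof -
  have "algebraic \<subseteq> {u. P u}" using algebraic_induct[OF _ assms(1,3)] by blast
  then have "closure algebraic \<subseteq> {u. P u}" using assms(2) by (rule closure_minimal)
  then show ?thesis using tensor_dense by blast
qed

lemma algebraic_expansion: "u \<in> algebraic \<Longrightarrow> \<exists>ps. u = (\<Sum>(b, x)\<leftarrow>ps. t b x)"
proof (erule algebraic_induct)
  show "csubspace {u. \<exists>ps. u = (\<Sum>(b, x)\<leftarrow>ps. t b x)}"
    unfolding complex_vector.subspace_def
  proof (intro conjI ballI allI)
    show "0 \<in> {u. \<exists>ps. u = (\<Sum>(b, x)\<leftarrow>ps. t b x)}" by (auto intro: exI[of _ "[]"])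
  next
    fix u v assume "u \<in> {u. \<exists>ps. u = (\<Sum>(b, x)\<leftarrow>ps. t b x)}" "v \<in> {u. \<exists>ps. u = (\<Sum>(b, x)\<leftarrow>ps. t b x)}"
    then obtain ps qs where "u = (\<Sum>(b, x)\<leftarrow>ps. t b x)" "v = (\<Sum>(b, x)\<leftarrow>qs. t b x)" by blast
    then have "u + v = (\<Sum>(b, x)\<leftarrow>ps @ qs. t b x)" by simp
    then show "u + v \<in> {u. \<exists>ps. u = (\<Sum>(b, x)\<leftarrow>ps. t b x)}" by blast
  next
    fix c u assume "u \<in> {u. \<exists>ps. u = (\<Sum>(b, x)\<leftarrow>ps. t b x)}"
    then obtain ps where ps: "u = (\<Sum>(b, x)\<leftarrow>ps. t b x)" by blast
    have "c *\<^sub>C (\<Sum>(b, x)\<leftarrow>ps. t b x) = (\<Sum>(b, x)\<leftarrow>map (\<lambda>(b, x). (c *\<^sub>C b, x)) ps. t b x)"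
      by (induction ps) (auto simp: tensor_scaleC scaleC_add_right)
    then show "c *\<^sub>C u \<in> {u. \<exists>ps. u = (\<Sum>(b, x)\<leftarrow>ps. t b x)}" unfolding ps by blast
  qed
  show "\<exists>ps. t b x = (\<Sum>(b, x)\<leftarrow>ps. t b x)" for b x
    by (rule exI[of _ "[(b, x)]"]) simp
qed

lemma norm_ge_of_expansions:
  assumes "u \<in> algebraic"
    and "\<And>ps. u = (\<Sum>(b, x)\<leftarrow>ps. t b x) \<Longrightarrow> r \<le> (\<Sum>(b, x)\<leftarrow>ps. norm b * norm x)"
  shows "r \<le> norm u"
  unfolding norm_projective[OF assms(1)]
  by (rule cInf_greatest) (use algebraic_expansion[OF assms(1)] assms(2) in auto)

lemma norm_t_le: "norm (t b x) \<le> norm b * norm x"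
  unfolding norm_projective[OF t_in_algebraic]
proof (rule cInf_lower)
  show "norm b * norm x \<in> {(\<Sum>(b, x)\<leftarrow>ps. norm b * norm x) | ps. t b x = (\<Sum>(b, x)\<leftarrow>ps. t b x)}"
    by (rule CollectI, rule exI[of _ "[(b, x)]"]) simp
  show "bdd_below {(\<Sum>(b, x)\<leftarrow>ps. norm b * norm x) | ps. t b x = (\<Sum>(b, x)\<leftarrow>ps. t b x)}"
    by (rule bdd_belowI[of _ 0]) (auto intro!: sum_list_nonneg)
qed

lemma bounded_linear_t_left: "bounded_linear (\<lambda>b. t b x)"
  by (rule bounded_linear_intro[of _ "norm x"]) (simp_all add: tensor_add t_scaleR norm_t_le)

lemma bounded_linear_t_right: "bounded_linear (\<lambda>x. t b x)"
  by (rule bounded_linear_intro[of _ "norm b"])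
    (simp_all add: tensor_add t_scaleR norm_t_le mult.commute[of "norm _" "norm b"])

text \<open>The second factors are rewritten over a maximal independent subset of those that occur.
  Faithfulness kills the collected coefficients \<open>f v\<close>, and the sliced sum is a
  combination of these.\<close>

lemma slice_well_defined:
  fixes \<tau> :: "'f \<Rightarrow> complex"
  assumes lin: "\<And>x y. \<tau> (x + y) = \<tau> x + \<tau> y" "\<And>c x. \<tau> (c *\<^sub>C x) = c * \<tau> x"
    and zero: "(\<Sum>(b, x)\<leftarrow>ps. t b x) = 0"
  shows "(\<Sum>(b, x)\<leftarrow>ps. \<tau> x *\<^sub>C b) = 0"
proof -
  obtain B where B: "B \<subseteq> snd ` set ps" "\<not> cdependent B" "snd ` set ps \<subseteq> cspan B"
    using complex_vector.maximal_independent_subset[of "snd ` set ps"] by blast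
  have fin: "finite B" using B(1) finite_surj by blast
  define r where "r = complex_vector.representation B"
  have r: "x = (\<Sum>v\<in>B. r x v *\<^sub>C v)" if "x \<in> snd ` set ps" for x
    unfolding r_def using B that fin
    by (intro complex_vector.sum_representation_eq[symmetric]) auto
  define f where "f v = (\<Sum>(b, x)\<leftarrow>ps. r x v *\<^sub>C b)" for v
  have \<tau>0: "\<tau> 0 = 0" using lin(2)[of 0 0] by simp
  have \<tau>_sum: "\<tau> (\<Sum>i\<in>A. g i) = (\<Sum>i\<in>A. \<tau> (g i))" for A :: "'f set" and g
    by (induction A rule: infinite_finite_induct) (simp_all add: \<tau>0 lin)
  have t_list: "t (\<Sum>(b, x)\<leftarrow>qs. r x v *\<^sub>C b) v = (\<Sum>(b, x)\<leftarrow>qs. t (r x v *\<^sub>C b) v)" for v and qs :: "('b \<times> 'f) list"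
    by (induction qs) (auto simp: t_zero tensor_add)
  have scale_list: "c *\<^sub>C (\<Sum>(b, x)\<leftarrow>qs. r x v *\<^sub>C b) = (\<Sum>(b, x)\<leftarrow>qs. (c * r x v) *\<^sub>C b)" for c v and qs :: "('b \<times> 'f) list"
    by (induction qs) (auto simp: scaleC_add_right scaleC_scaleC)
  have "(\<Sum>v\<in>B. t (f v) v) = (\<Sum>v\<in>B. \<Sum>p\<leftarrow>ps. t (r (snd p) v *\<^sub>C fst p) v)"
    unfolding f_def t_list by (simp add: case_prod_unfold)
  also have "\<dots> = (\<Sum>p\<leftarrow>ps. \<Sum>v\<in>B. t (r (snd p) v *\<^sub>C fst p) v)"
    by (rule sum_list_sum_swap[symmetric])
  also have "\<dots> = (\<Sum>p\<leftarrow>ps. t (fst p) (snd p))"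
  proof (intro arg_cong[of _ _ sum_list] map_cong refl)
    fix p assume "p \<in> set ps"
    then have "t (fst p) (snd p) = t (fst p) (\<Sum>v\<in>B. r (snd p) v *\<^sub>C v)" using r[of "snd p"] by auto
    then show "(\<Sum>v\<in>B. t (r (snd p) v *\<^sub>C fst p) v) = t (fst p) (snd p)"
      by (simp add: t_sum tensor_scaleC)
  qed
  also have "\<dots> = 0" using zero by (simp add: case_prod_unfold)
  finally have f0: "f v = 0" if "v \<in> B" for v
    using tensor_faithful[OF fin B(2)] that by blast
  have "(\<Sum>p\<leftarrow>ps. \<tau> (snd p) *\<^sub>C fst p) = (\<Sum>p\<leftarrow>ps. \<Sum>v\<in>B. (\<tau> v * r (snd p) v) *\<^sub>C fst p)"
  proof (intro arg_cong[of _ _ sum_list] map_cong refl)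
    fix p assume "p \<in> set ps"
    then have "\<tau> (snd p) = \<tau> (\<Sum>v\<in>B. r (snd p) v *\<^sub>C v)" using r[of "snd p"] by auto
    also have "\<dots> = (\<Sum>v\<in>B. \<tau> v * r (snd p) v)" by (simp add: \<tau>_sum lin mult.commute)
    finally show "\<tau> (snd p) *\<^sub>C fst p = (\<Sum>v\<in>B. (\<tau> v * r (snd p) v) *\<^sub>C fst p)"
      by (simp only: complex_vector.scale_sum_left)
  qed
  also have "\<dots> = (\<Sum>v\<in>B. \<Sum>p\<leftarrow>ps. (\<tau> v * r (snd p) v) *\<^sub>C fst p)" by (rule sum_list_sum_swap)
  also have "\<dots> = (\<Sum>v\<in>B. \<tau> v *\<^sub>C f v)"
    unfolding f_def scale_list by (simp add: case_prod_unfold)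
  finally show ?thesis using f0 by (simp add: case_prod_unfold)
qed

end

locale uhf_tensor = uhf_system S k e + projective_tensor_product t
  for S :: "nat \<Rightarrow> 'f::unital_cstar_algebra set" and k e
    and t :: "'b::unital_complex_banach_algebra \<Rightarrow> 'f \<Rightarrow> 'a::complex_banach_algebra"
begin

text \<open>Slicing any expansion of \<open>t b 1\<close> by the contractive trace expresses
  \<open>b\<close> with no larger cost, so the infimum over expansions is at least
  \<open>norm b\<close>.\<close>

lemma norm_t_one_ge: "norm b \<le> norm (t b 1)"
proof (rule norm_ge_of_expansions[OF t_in_algebraic])
  fix ps assume ps: "t b 1 = (\<Sum>(b, x)\<leftarrow>ps. t b x)"
  \<comment> \<open>Prepending \<open>(- b, 1)\<close> turns the expansion into a vanishing sum, the
    form that \<open>slice_well_defined\<close> handles.\<close>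
  have "t (- b) 1 = - t b 1" using linear_neg[OF linear_t_left] .
  then have "(\<Sum>(b, x)\<leftarrow>(- b, 1) # ps. t b x) = 0" by (simp flip: ps)
  from slice_well_defined[OF tr_add tr_scaleC this]
  have "- b + (\<Sum>(b, x)\<leftarrow>ps. tr x *\<^sub>C b) = 0" by (simp add: tr_one)
  from minus_unique[OF this] have "b = (\<Sum>(b, x)\<leftarrow>ps. tr x *\<^sub>C b)" by simp
  also have "norm \<dots> \<le> (\<Sum>(b, x)\<leftarrow>ps. norm b * norm x)"
  proof (induction ps)
    case (Cons p ps)
    have "norm (tr (snd p) *\<^sub>C fst p) \<le> norm (fst p) * norm (snd p)"
      unfolding norm_scaleC mult.commute[of "cmod _"] by (intro mult_left_mono norm_tr_le norm_ge_zero)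
    then show ?case using Cons by (auto simp: case_prod_unfold intro: norm_triangle_mono)
  qed simp
  finally show "norm b \<le> (\<Sum>(b, x)\<leftarrow>ps. norm b * norm x)" .
qed

lemma t_one_inj: "t b 1 = t b' 1 \<Longrightarrow> b = b'"
  using norm_t_one_ge[of "b - b'"] by (simp add: t_diff)

lemma closed_range_t_one: "closed (range (\<lambda>b. t b 1))"
  by (rule closed_range_bounded_below[OF bounded_linear_t_left, of 1]) (simp_all add: norm_t_one_ge)

lemma t_one_one: "t 1 1 * a = a" "a * t 1 1 = a"
proof -
  show "t 1 1 * a = a"
  proof (rule tensor_induct[of "\<lambda>a. t 1 1 * a = a"])
    show "csubspace {a. t 1 1 * a = a}"
      by (simp add: complex_vector.subspace_def distrib_left mult_scaleC_right)
    show "closed {a. t 1 1 * a = a}" by (intro closed_Collect_eq continuous_intros)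
  qed (simp add: tensor_mult)
  show "a * t 1 1 = a"
  proof (rule tensor_induct[of "\<lambda>a. a * t 1 1 = a"])
    show "csubspace {a. a * t 1 1 = a}"
      by (simp add: complex_vector.subspace_def distrib_right mult_scaleC_left)
    show "closed {a. a * t 1 1 = a}" by (intro closed_Collect_eq continuous_intros)
  qed (simp add: tensor_mult)
qed

lemma matrix_units_t: "matrix_units (k n) (\<lambda>i j. t 1 (e n i j)) (t 1 1)"
proof
  show "k n > 0" by (rule mu.k_pos)
  show "t 1 (e n i j) * t 1 (e n p q) = (if j = p then t 1 (e n i q) else 0)"
    if "i < k n" "j < k n" "p < k n" "q < k n" for i j p q
    using that by (simp add: tensor_mult mu.unit_mult t_zero)
  show "(\<Sum>i<k n. t 1 (e n i i)) = t 1 1" by (simp add: t_sum[symmetric] mu.sum_diag)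
qed (rule t_one_one)+

end

sublocale uhf_tensor \<subseteq> mt: matrix_units "k n" "\<lambda>i j. t 1 (e n i j)" "t 1 1" for n
  by (rule matrix_units_t)

section \<open>Averages on the tensor product and the slice map\<close>

context uhf_tensor
begin

lemma weyl_t: "mt.weyl n r s = t 1 (mu.weyl n r s)" "mt.weyl' n r s = t 1 (mu.weyl' n r s)"
  by (simp_all add: mt.weyl_def mu.weyl_def mt.weyl'_def mu.weyl'_def t_sum tensor_scaleC)

text \<open>The norm of the unit of B enters because it may differ from 1; the bound is still
  independent of \<open>n\<close>.\<close>

lemma norm_expect_t: "norm (mt.expect n a) \<le> (norm (1::'b))\<^sup>2 * norm a"
proof (rule mt.norm_expect)
  fix r s
  have le: "norm (t 1 x) \<le> norm (1::'b)" if "norm x \<le> 1" for x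
    using norm_t_le[of 1 x] mult_left_mono[OF that, of "norm (1::'b)"] by simp
  show "norm (mt.weyl n r s) \<le> norm (1::'b)" "norm (mt.weyl' n r s) \<le> norm (1::'b)"
    unfolding weyl_t by (intro le mu.norm_weyl)+
qed

lemma expect_t: "mt.expect n (t b x) = t b (mu.expect n x)"
  by (simp add: mt.expect_def mu.expect_def mt.csum_def mu.csum_def t_sum tensor_scaleC tensor_mult)

lemma expect_t_limit: "(\<lambda>n. mt.expect n (t b x)) \<longlonglongrightarrow> t (tr x *\<^sub>C b) 1"
  using bounded_linear.tendsto[OF bounded_linear_t_right tr_limit, of b x]
  by (simp add: expect_t tensor_scaleC)

text \<open>Elementary tensors have limits \<open>t (tr x *\<^sub>C b) 1\<close> by
  \<open>expect_t_limit\<close>. The uniform bound and the closed range of \<open>t b 1\<close>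
  carry this to all of A.\<close>

lemma slice_exists: "\<exists>b. (\<lambda>n. mt.expect n a) \<longlonglongrightarrow> t b 1"
proof -
  have "\<exists>b. (\<lambda>n. mt.expect n u) \<longlonglongrightarrow> t b 1" if "u \<in> algebraic" for u
    using that
  proof (rule algebraic_induct)
    show "csubspace {u. \<exists>b. (\<lambda>n. mt.expect n u) \<longlonglongrightarrow> t b 1}"
    proof (rule complex_vector.subspaceI; unfold mem_Collect_eq)
      show "\<exists>b. (\<lambda>n. mt.expect n 0) \<longlonglongrightarrow> t b 1"
        by (rule exI[of _ 0]) (simp add: t_zero mt.expect_zero)
    next
      fix u v
      assume "\<exists>b. (\<lambda>n. mt.expect n u) \<longlonglongrightarrow> t b 1" "\<exists>b. (\<lambda>n. mt.expect n v) \<longlonglongrightarrow> t b 1"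
      then obtain b c where "(\<lambda>n. mt.expect n u) \<longlonglongrightarrow> t b 1" "(\<lambda>n. mt.expect n v) \<longlonglongrightarrow> t c 1"
        by blast
      then show "\<exists>b. (\<lambda>n. mt.expect n (u + v)) \<longlonglongrightarrow> t b 1"
        by (intro exI[of _ "b + c"]) (simp add: tensor_add mt.expect_add tendsto_add)
    next
      fix u c assume "\<exists>b. (\<lambda>n. mt.expect n u) \<longlonglongrightarrow> t b 1"
      then obtain b where "(\<lambda>n. mt.expect n u) \<longlonglongrightarrow> t b 1" by blast
      then show "\<exists>b. (\<lambda>n. mt.expect n (c *\<^sub>C u)) \<longlonglongrightarrow> t b 1"
        by (intro exI[of _ "c *\<^sub>C b"]) (simp add: tensor_scaleC mt.expect_scaleC tendsto_scaleC)
    qed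
    show "\<exists>b. (\<lambda>n. mt.expect n (t b' x)) \<longlonglongrightarrow> t b 1" for b' x
      using expect_t_limit by blast
  qed
  then have "\<exists>r\<in>range (\<lambda>b. t b 1). (\<lambda>n. mt.expect n u) \<longlonglongrightarrow> r" if "u \<in> algebraic" for u
    using that by blast
  then have "\<exists>r\<in>range (\<lambda>b. t b 1). (\<lambda>n. mt.expect n a) \<longlonglongrightarrow> r"
    by (rule limit_in_closed[where T = mt.expect, OF mt.linear_expect norm_expect_t _ closed_range_t_one tensor_dense])
  then show ?thesis by blast
qed

text \<open>The map id \<otimes> \<tau>. Defining it through averages lets a closed Lie ideal pass
  from \<open>a\<close> to \<open>t (slice a) 1\<close>.\<close>

definition slice :: "'a \<Rightarrow> 'b" where
  "slice a = (THE b. (\<lambda>n. mt.expect n a) \<longlonglongrightarrow> t b 1)"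

lemma slice_eqI: "(\<lambda>n. mt.expect n a) \<longlonglongrightarrow> t b 1 \<Longrightarrow> slice a = b"
  unfolding slice_def by (rule the_equality) (auto dest: LIMSEQ_unique intro: t_one_inj)

lemma slice_limit: "(\<lambda>n. mt.expect n a) \<longlonglongrightarrow> t (slice a) 1"
proof -
  obtain b where "(\<lambda>n. mt.expect n a) \<longlonglongrightarrow> t b 1" using slice_exists by blast
  with slice_eqI[OF this] show ?thesis by simp
qed

lemma slice_t: "slice (t b x) = tr x *\<^sub>C b"
  by (rule slice_eqI) (rule expect_t_limit)

lemma slice_add: "slice (a + a') = slice a + slice a'"
  by (rule slice_eqI) (simp add: mt.expect_add tensor_add tendsto_add slice_limit)

lemma slice_scaleC: "slice (c *\<^sub>C a) = c *\<^sub>C slice a"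
  by (rule slice_eqI) (simp add: mt.expect_scaleC tensor_scaleC tendsto_scaleC slice_limit)

lemma bounded_linear_slice: "bounded_linear slice"
proof (rule bounded_linear_intro)
  show "slice (r *\<^sub>R a) = r *\<^sub>R slice a" for r a
    by (simp only: scaleC_of_real[symmetric] slice_scaleC)
  show "norm (slice a) \<le> norm a * (norm (1::'b))\<^sup>2" for a
  proof -
    have "norm (t (slice a) 1) \<le> (norm (1::'b))\<^sup>2 * norm a"
      by (rule Lim_norm_ubound[OF _ slice_limit]) (simp_all add: norm_expect_t)
    then show ?thesis using norm_t_one_ge[of "slice a"] by (simp add: mult.commute)
  qed
qed (rule slice_add)

lemmas slice_diff = linear_diff[OF bounded_linear.linear[OF bounded_linear_slice]]
lemmas slice_sum = linear_sum[OF bounded_linear.linear[OF bounded_linear_slice]]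

end

section \<open>Approximation by finite sums of tensors\<close>

context uhf_tensor
begin

text \<open>The operator id \<otimes> \<open>proj n\<close>, obtained from the formula of
  \<open>proj\<close> by putting \<open>slice\<close> in the place of the trace.\<close>

definition tproj :: "nat \<Rightarrow> 'a \<Rightarrow> 'a" where
  "tproj n a = of_nat (k n) *\<^sub>C (\<Sum>i<k n. \<Sum>j<k n. t (slice (a * t 1 (e n j i))) (e n i j))"

lemma tproj_add: "tproj n (a + b) = tproj n a + tproj n b"
  by (simp add: tproj_def distrib_right slice_add tensor_add sum.distrib scaleC_add_right)

lemma tproj_scaleC: "tproj n (c *\<^sub>C a) = c *\<^sub>C tproj n a"
  by (simp add: tproj_def mult_scaleC_left slice_scaleC tensor_scaleC sum_scaleC_right mult_ac)

lemma linear_tproj: "linear (tproj n)"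
  by (rule linearI) (simp_all add: tproj_add tproj_scaleC scaleC_of_real[symmetric])

lemma tproj_t: "tproj n (t b x) = t b (proj n x)"
  by (simp add: tproj_def proj_def tensor_mult slice_t t_sum tensor_scaleC sum_scaleC_right)

text \<open>Applying the contraction \<open>proj n\<close> to the second factors does not increase
  the cost of an expansion; the infimum gives the bound on finite sums, and density extends
  it.\<close>

lemma norm_tproj_le: "norm (tproj n a) \<le> norm a"
proof -
  have alg: "norm (tproj n u) \<le> norm u" if "u \<in> algebraic" for u
  proof (rule norm_ge_of_expansions[OF that])
    fix ps assume "u = (\<Sum>(b, x)\<leftarrow>ps. t b x)"
    moreover have "norm (tproj n (\<Sum>(b, x)\<leftarrow>ps. t b x)) \<le> (\<Sum>(b, x)\<leftarrow>ps. norm b * norm x)"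
    proof (induction ps)
      case Nil
      then show ?case by (simp add: linear_0[OF linear_tproj])
    next
      case (Cons p ps)
      have "norm (tproj n (t (fst p) (snd p))) \<le> norm (fst p) * norm (proj n (snd p))"
        unfolding tproj_t by (rule norm_t_le)
      also have "\<dots> \<le> norm (fst p) * norm (snd p)"
        by (intro mult_left_mono norm_proj_le norm_ge_zero)
      finally show ?case using Cons by (auto simp: case_prod_unfold tproj_add intro: norm_triangle_mono)
    qed
    ultimately show "norm (tproj n u) \<le> (\<Sum>(b, x)\<leftarrow>ps. norm b * norm x)" by simp
  qed
  have "continuous_on UNIV (\<lambda>a. tproj n a)"
    unfolding tproj_def
    by (intro continuous_intros bounded_linear.continuous_on[OF bounded_linear_scaleC]
        bounded_linear.continuous_on[OF bounded_linear_t_left]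
        bounded_linear.continuous_on[OF bounded_linear_slice])
  then have "closed {a. norm (tproj n a) \<le> norm a}"
    by (intro closed_Collect_le continuous_intros)
  then have "closure algebraic \<subseteq> {a. norm (tproj n a) \<le> norm a}"
    using alg by (intro closure_minimal) auto
  then show ?thesis using tensor_dense by blast
qed

lemma tproj_limit: "(\<lambda>n. tproj n a) \<longlonglongrightarrow> a"
proof (rule tendsto_of_dense[where T = tproj and T' = "\<lambda>a. a" and C = 1 and C' = 1, OF linear_tproj _ _ _ _ tensor_dense])
  show "linear (\<lambda>a :: 'a. a)" by (rule linearI) auto
  fix u assume "u \<in> algebraic"
  then show "(\<lambda>n. tproj n u) \<longlonglongrightarrow> u"
  proof (rule algebraic_induct)
    show "csubspace {u. (\<lambda>n. tproj n u) \<longlonglongrightarrow> u}"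
      by (rule complex_vector.subspaceI)
        (simp_all add: linear_0[OF linear_tproj] tproj_add tproj_scaleC tendsto_add tendsto_scaleC)
    show "(\<lambda>n. tproj n (t b x)) \<longlonglongrightarrow> t b x" for b x
      unfolding tproj_t by (rule bounded_linear.tendsto[OF bounded_linear_t_right proj_limit])
  qed
qed (simp_all add: norm_tproj_le)

text \<open>The traceless part of a matrix unit: only the diagonal ones have a trace, namely
  1/k.\<close>

definition unit0 :: "nat \<Rightarrow> nat \<Rightarrow> nat \<Rightarrow> 'f" where
  "unit0 n i j = e n i j - (if i = j then inverse (of_nat (k n)) else 0) *\<^sub>C 1"

lemma unit0_in: "i < k n \<Longrightarrow> j < k n \<Longrightarrow> unit0 n i j \<in> S n"
  unfolding unit0_def
  by (intro complex_vector.subspace_diff complex_vector.subspace_scale subspace unit_in one_in)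

lemma tr_unit0: "i < k n \<Longrightarrow> j < k n \<Longrightarrow> tr (unit0 n i j) = 0"
  by (simp add: unit0_def tr_diff tr_scaleC tr_one tr_unit)

text \<open>Removing the trace from both tensor factors subtracts exactly the slice. The result is a
  finite sum whose summands can be placed in the ideal part tensor \<tau>-kernel.\<close>

lemma tproj_minus_slice:
  "tproj n a - t (slice a) 1 =
    of_nat (k n) *\<^sub>C (\<Sum>i<k n. \<Sum>j<k n. t (slice (a * t 1 (unit0 n j i))) (unit0 n i j))"
proof -
  define s where "s i j = slice (a * t 1 (e n j i))" for i j
  define K where "K = inverse (of_nat (k n) :: complex)"
  have K: "of_nat (k n) * K = 1" using mu.k_pos[of n] by (simp add: K_def)
  have sum_s: "(\<Sum>i<k n. s i i) = slice a"
    by (simp add: s_def slice_sum[symmetric] sum_distrib_left[symmetric] mt.sum_diag t_one_one)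
  have slice0: "slice (a * t 1 (unit0 n j i)) = s i j - (if i = j then K else 0) *\<^sub>C slice a" for i j
    by (simp add: unit0_def t_diff tensor_scaleC right_diff_distrib slice_diff mult_scaleC_right
        slice_scaleC t_one_one s_def K_def)
  have "(\<Sum>i<k n. \<Sum>j<k n. t (slice (a * t 1 (unit0 n j i))) (unit0 n i j)) =
      (\<Sum>i<k n. \<Sum>j<k n. t (s i j) (e n i j) +
        (if i = j then (K * K) *\<^sub>C t (slice a) 1 - K *\<^sub>C t (slice a) (e n i i) - K *\<^sub>C t (s i i) 1 else 0))"
    unfolding slice0
    by (intro sum.cong refl)
      (auto simp: unit0_def t_diff tensor_scaleC K_def scaleC_scaleC complex_vector.scale_right_diff_distrib)
  \<comment> \<open>As kK = 1, the three corrections add up to K - K - K = -K times the slice, and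
    the outer factor k makes this -1.\<close>
  also have "\<dots> = (\<Sum>i<k n. \<Sum>j<k n. t (s i j) (e n i j)) +
      ((of_nat (k n) * K * K) *\<^sub>C t (slice a) 1 - K *\<^sub>C t (slice a) 1 - K *\<^sub>C t (slice a) 1)"
  proof -
    have "(\<Sum>i<k n. K *\<^sub>C t (slice a) (e n i i)) = K *\<^sub>C t (slice a) 1"
      by (simp add: sum_scaleC_right[symmetric] t_sum[symmetric] mu.sum_diag)
    moreover have "(\<Sum>i<k n. K *\<^sub>C t (s i i) 1) = K *\<^sub>C t (slice a) 1"
      by (simp add: sum_scaleC_right[symmetric] t_sum[symmetric] sum_s)
    moreover have "(\<Sum>i<k n. (K * K) *\<^sub>C t (slice a) 1) = (of_nat (k n) * K * K) *\<^sub>C t (slice a) 1"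
      by (simp add: complex_vector.scale_sum_left[symmetric] mult.assoc)
    ultimately show ?thesis by (simp add: sum.distrib sum_subtractf)
  qed
  also have "\<dots> = (\<Sum>i<k n. \<Sum>j<k n. t (s i j) (e n i j)) - K *\<^sub>C t (slice a) 1"
    by (simp add: K)
  finally show ?thesis
    by (simp add: tproj_def s_def complex_vector.scale_right_diff_distrib scaleC_scaleC K)
qed

end

section \<open>Closed Lie ideals\<close>

locale uhf_tensor_lie = uhf_tensor S k e t
  for S :: "nat \<Rightarrow> 'f::unital_cstar_algebra set" and k e
    and t :: "'b::unital_complex_banach_algebra \<Rightarrow> 'f \<Rightarrow> 'a::complex_banach_algebra" +
  fixes L :: "'a set"
  assumes closed_lie_ideal: "closed_lie_ideal L"
begin

lemma subspace_L: "csubspace L" and closed_L: "closed L"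
  and lie: "x \<in> L \<Longrightarrow> a * x - x * a \<in> L"
  using closed_lie_ideal by (simp_all add: closed_lie_ideal_def)

lemma lie': "x \<in> L \<Longrightarrow> x * a - a * x \<in> L"
  using complex_vector.subspace_neg[OF subspace_L lie[of x a]] by simp

definition ideal_part :: "'b set" where
  "ideal_part = {b. \<forall>x. tr x = 0 \<longrightarrow> t b x \<in> L}"

definition lie_part :: "'b set" where
  "lie_part = {m. t m 1 \<in> L}"

lemma slice_in_lie_part: "a \<in> L \<Longrightarrow> slice a \<in> lie_part"
  unfolding lie_part_def mem_Collect_eq
  by (rule closed_sequentially[OF closed_L _ slice_limit]) (rule mt.expect_lie[OF subspace_L lie])

text \<open>On \<open>B \<otimes> F\<^sub>n\<close> the operator in question sends \<open>b \<otimes> f\<close> to \<open>tr (f * x) b \<otimes> y\<close>. It is generated by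
  commutators with \<open>1 \<otimes> F\<^sub>n\<close>, because the adjoint action on the traceless matrices is irreducible.\<close>

lemma mult_expect_in:
  assumes z: "z \<in> L" and x: "x \<in> S n" "tr x = 0" and y: "y \<in> S n" "tr y = 0"
  shows "t 1 y * mt.expect n (z * t 1 x) \<in> L"
proof -
  \<comment> \<open>First \<open>x\<close> is a single off-diagonal unit and only \<open>y\<close>
    varies, starting from \<open>unit_expect_lie\<close>.\<close>
  have left: "t 1 y * mt.expect n (z * t 1 (e n c d)) \<in> L"
    if z: "z \<in> L" and cd: "c < k n" "d < k n" "c \<noteq> d" for z c d
  proof -
    let ?E = "mt.expect n (z * t 1 (e n c d))"
    have "y \<in> {y. t 1 y * ?E \<in> L}"
    proof (rule trace_zero_induct[OF _ _ _ y])
      show "csubspace {y. t 1 y * ?E \<in> L}"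
        by (rule complex_vector.subspaceI)
          (simp_all add: t_zero tensor_add tensor_scaleC distrib_right mult_scaleC_left
            complex_vector.subspace_0[OF subspace_L] complex_vector.subspace_add[OF subspace_L]
            complex_vector.subspace_scale[OF subspace_L])
      show "e n i j \<in> {y. t 1 y * ?E \<in> L}" if "i < k n" "j < k n" "i \<noteq> j" for i j
        using mt.unit_expect_lie[OF subspace_L lie z that(1,2) cd(1,2) that(3) cd(3)] by simp
      fix i j v assume ij: "i < k n" "j < k n" and v: "v \<in> {y. t 1 y * ?E \<in> L}"
      have "t 1 (e n i j * v - v * e n i j) * ?E =
          t 1 (e n i j) * (t 1 v * ?E) - t 1 v * (t 1 (e n i j) * ?E)"
        by (simp add: t_diff left_diff_distrib mult.assoc[symmetric] tensor_mult)
      \<comment> \<open>The average commutes with the units, so a commutator in the factor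
        \<open>v\<close> is a commutator of the whole product, which stays in
        \<open>L\<close>.\<close>
      also have "\<dots> = t 1 (e n i j) * (t 1 v * ?E) - (t 1 v * ?E) * t 1 (e n i j)"
        unfolding mt.expect_commute[OF ij] by (simp add: mult.assoc)
      finally show "e n i j * v - v * e n i j \<in> {y. t 1 y * ?E \<in> L}"
        using lie v by simp
    qed
    then show ?thesis by simp
  qed
  \<comment> \<open>All \<open>z\<close> are quantified inside the set, because a commutator in
    \<open>x\<close> is transferred to a commutator in \<open>z\<close> by the tracial
    property.\<close>
  have "x \<in> {x. \<forall>z\<in>L. t 1 y * mt.expect n (z * t 1 x) \<in> L}"
  proof (rule trace_zero_induct[OF _ _ _ x])
    show "csubspace {x. \<forall>z\<in>L. t 1 y * mt.expect n (z * t 1 x) \<in> L}"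
      by (rule complex_vector.subspaceI)
        (simp_all add: t_zero mt.expect_zero tensor_add tensor_scaleC distrib_left mult_scaleC_right
          mt.expect_add mt.expect_scaleC
          complex_vector.subspace_0[OF subspace_L] complex_vector.subspace_add[OF subspace_L]
          complex_vector.subspace_scale[OF subspace_L])
    show "e n i j \<in> {x. \<forall>z\<in>L. t 1 y * mt.expect n (z * t 1 x) \<in> L}"
      if "i < k n" "j < k n" "i \<noteq> j" for i j
      using left that by blast
    fix i j v
    assume ij: "i < k n" "j < k n" and v: "v \<in> {x. \<forall>z\<in>L. t 1 y * mt.expect n (z * t 1 x) \<in> L}"
    have "mt.expect n (z * t 1 (e n i j * v - v * e n i j)) =
        mt.expect n ((z * t 1 (e n i j) - t 1 (e n i j) * z) * t 1 v)" for z
    proof -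
      have "mt.expect n (z * t 1 (e n i j * v - v * e n i j)) =
          mt.expect n (z * t 1 (e n i j) * t 1 v) - mt.expect n (z * t 1 v * t 1 (e n i j))"
        by (simp add: linear_diff[OF mt.linear_expect, symmetric] t_diff right_diff_distrib
            mult.assoc tensor_mult)
      also have "mt.expect n (z * t 1 v * t 1 (e n i j)) = mt.expect n (t 1 (e n i j) * (z * t 1 v))"
        by (rule mt.expect_tracial[OF ij])
      finally show ?thesis
        by (simp add: linear_diff[OF mt.linear_expect, symmetric] left_diff_distrib mult.assoc)
    qed
    then show "e n i j * v - v * e n i j \<in> {x. \<forall>z\<in>L. t 1 y * mt.expect n (z * t 1 x) \<in> L}"
      using v lie' by simp
  qed
  then show ?thesis using z by blast
qed

text \<open>Subtracting \<open>tr x\<close> times 1 projects F continuously onto the traceless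
  elements and maps each \<open>S n\<close> into itself; so density of the union passes to the
  kernel of the trace.\<close>

lemma in_ideal_partI:
  assumes "\<And>n y. \<lbrakk>y \<in> S n; tr y = 0\<rbrakk> \<Longrightarrow> t b y \<in> L"
  shows "b \<in> ideal_part"
proof -
  have *: "t b (x - tr x *\<^sub>C 1) \<in> L" for x
  proof (rule dense_induct[of "\<lambda>x. t b (x - tr x *\<^sub>C 1) \<in> L"])
    have "continuous_on UNIV (\<lambda>x. t b (x - tr x *\<^sub>C 1))"
      unfolding t_diff tensor_scaleC
      by (intro continuous_intros bounded_linear.continuous_on[OF bounded_linear_t_right]
          bounded_linear.continuous_on[OF bounded_linear_scaleC_left] continuous_tr)
    from continuous_closed_preimage[OF this closed_UNIV closed_L]
    show "closed {x. t b (x - tr x *\<^sub>C 1) \<in> L}" by (simp add: vimage_def)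
  next
    fix n x assume "x \<in> S n"
    then show "t b (x - tr x *\<^sub>C 1) \<in> L"
      by (intro assms[of _ n] complex_vector.subspace_diff complex_vector.subspace_scale subspace one_in)
        (simp_all add: tr_diff tr_scaleC tr_one)
  qed
  have "t b x \<in> L" if "tr x = 0" for x using *[of x] that by simp
  then show ?thesis by (simp add: ideal_part_def)
qed

text \<open>Beyond the levels of \<open>x\<close> and \<open>y\<close> the products from
  \<open>mult_expect_in\<close> lie in \<open>L\<close>, and they converge to the slice tensored
  with \<open>y\<close>.\<close>

lemma slice_in_ideal_part:
  assumes z: "z \<in> L" and x: "x \<in> S m" "tr x = 0"
  shows "slice (z * t 1 x) \<in> ideal_part"
proof (rule in_ideal_partI)
  fix n y assume y: "y \<in> S n" "tr y = 0"
  have lim: "(\<lambda>l. t 1 y * mt.expect l (z * t 1 x)) \<longlonglongrightarrow> t 1 y * t (slice (z * t 1 x)) 1"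
    by (intro tendsto_intros slice_limit)
  have "\<forall>\<^sub>F l in sequentially. t 1 y * mt.expect l (z * t 1 x) \<in> L"
    using S_mono[OF _ x(1)] S_mono[OF _ y(1)]
    by (intro eventually_sequentiallyI[of "max m n"] mult_expect_in z x y) auto
  then have "t 1 y * t (slice (z * t 1 x)) 1 \<in> L"
    by (rule Lim_in_closed_set[OF closed_L _ sequentially_bot lim])
  then show "t (slice (z * t 1 x)) y \<in> L" by (simp add: tensor_mult)
qed

lemma subspace_ideal_part: "csubspace ideal_part"
  unfolding ideal_part_def
  by (rule complex_vector.subspaceI)
    (simp_all add: t_zero tensor_add tensor_scaleC complex_vector.subspace_0[OF subspace_L]
      complex_vector.subspace_add[OF subspace_L] complex_vector.subspace_scale[OF subspace_L])

lemma closed_preimage_t: "closed {b. t b x \<in> L}"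
  using continuous_closed_preimage[OF _ closed_UNIV closed_L, of "\<lambda>b. t b x"]
  by (simp add: vimage_def linear_continuous_on bounded_linear_t_left)

text \<open>Since \<open>e n i i\<close> is a left unit for \<open>e n i j\<close> and annihilates
  it from the right when i \<noteq> j, a commutator with \<open>t c (e n i i)\<close> acts as left
  multiplication by \<open>c\<close>. The unit \<open>e n j j\<close> does the same on the
  right.\<close>

lemma closed_ideal_ideal_part: "closed_ideal ideal_part"
  unfolding closed_ideal_def
proof (intro conjI allI ballI)
  show "csubspace ideal_part" by (rule subspace_ideal_part)
  have "ideal_part = (\<Inter>x\<in>{x. tr x = 0}. {b. t b x \<in> L})" by (auto simp: ideal_part_def)
  then show "closed ideal_part" by (simp add: closed_INT closed_preimage_t)
next
  fix c b assume b: "b \<in> ideal_part"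
  have tb: "t b (e n i j) \<in> L" if "i < k n" "j < k n" "i \<noteq> j" for n i j
    using b that by (simp add: ideal_part_def tr_unit)
  have ad: "t 1 f * t b' v - t b' v * t 1 f = t b' (f * v - v * f)" for b' f v
    by (simp add: tensor_mult t_diff)
  \<comment> \<open>Off-diagonal units suffice, as commutators with \<open>t 1 (e n i j)\<close>
    generate the remaining traceless matrices.\<close>
  have ideal: "b' \<in> ideal_part"
    if off: "\<And>n i j. \<lbrakk>i < k n; j < k n; i \<noteq> j\<rbrakk> \<Longrightarrow> t b' (e n i j) \<in> L" for b'
  proof (rule in_ideal_partI)
    fix n y assume y: "y \<in> S n" "tr y = 0"
    have "y \<in> {y. t b' y \<in> L}"
    proof (rule trace_zero_induct[OF _ _ _ y])
      show "csubspace {y. t b' y \<in> L}"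
        by (rule complex_vector.subspaceI)
          (simp_all add: t_zero tensor_add tensor_scaleC complex_vector.subspace_0[OF subspace_L]
            complex_vector.subspace_add[OF subspace_L] complex_vector.subspace_scale[OF subspace_L])
    qed (use off lie ad[symmetric] in auto)
    then show "t b' y \<in> L" by simp
  qed
  show "c * b \<in> ideal_part"
  proof (rule ideal)
    fix n i j assume ij: "i < k n" "j < k n" "i \<noteq> j"
    have "t c (e n i i) * t b (e n i j) - t b (e n i j) * t c (e n i i) = t (c * b) (e n i j)"
      using ij by (simp add: tensor_mult mu.unit_mult t_zero)
    then show "t (c * b) (e n i j) \<in> L" using lie[OF tb[OF ij], of "t c (e n i i)"] by simp
  qed
  show "b * c \<in> ideal_part"
  proof (rule ideal)
    fix n i j assume ij: "i < k n" "j < k n" "i \<noteq> j"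
    have "t b (e n i j) * t c (e n j j) - t c (e n j j) * t b (e n i j) = t (b * c) (e n i j)"
      using ij by (simp add: tensor_mult mu.unit_mult t_zero)
    then show "t (b * c) (e n i j) \<in> L" using lie'[OF tb[OF ij], of "t c (e n j j)"] by simp
  qed
qed

lemma closed_lie_ideal_lie_part: "closed_lie_ideal lie_part"
  unfolding closed_lie_ideal_def
proof (intro conjI allI ballI)
  show "csubspace lie_part"
    unfolding lie_part_def
    by (rule complex_vector.subspaceI)
      (simp_all add: t_zero tensor_add tensor_scaleC complex_vector.subspace_0[OF subspace_L]
        complex_vector.subspace_add[OF subspace_L] complex_vector.subspace_scale[OF subspace_L])
  show "closed lie_part" unfolding lie_part_def by (rule closed_preimage_t)
  fix a x assume "x \<in> lie_part"
  then show "a * x - x * a \<in> lie_part"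
    using lie[of "t x 1" "t a 1"] by (simp add: lie_part_def tensor_mult t_diff)
qed

lemma closed_tensor_span_subset: "closed_tensor_span t ideal_part trace_kernel \<subseteq> L"
  unfolding closed_tensor_span_def
  by (intro closure_minimal complex_vector.span_minimal closed_L subspace_L)
    (auto simp: trace_kernel_def the_trace_eq ideal_part_def)

lemma minus_slice_in:
  assumes a: "a \<in> L"
  shows "a - t (slice a) 1 \<in> closed_tensor_span t ideal_part trace_kernel"
proof -
  let ?J = "cspan {t b x | b x. b \<in> ideal_part \<and> x \<in> trace_kernel}"
  have "tproj n a - t (slice a) 1 \<in> ?J" for n
    unfolding tproj_minus_slice
  proof (intro complex_vector.span_scale complex_vector.span_sum)
    fix i j assume "i \<in> {..<k n}" "j \<in> {..<k n}"
    then have ij: "i < k n" "j < k n" by simp_all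
    \<comment> \<open>The traceless unit in the slice is what puts the first tensor factor into the
      ideal.\<close>
    have "slice (a * t 1 (unit0 n j i)) \<in> ideal_part"
      by (rule slice_in_ideal_part[OF a unit0_in[OF ij(2,1)] tr_unit0[OF ij(2,1)]])
    moreover have "unit0 n i j \<in> trace_kernel"
      by (simp add: trace_kernel_def the_trace_eq tr_unit0[OF ij])
    ultimately
    show "t (slice (a * t 1 (unit0 n j i))) (unit0 n i j) \<in> ?J"
      by (intro complex_vector.span_base) blast
  qed
  moreover have "(\<lambda>n. tproj n a - t (slice a) 1) \<longlonglongrightarrow> a - t (slice a) 1"
    by (intro tendsto_intros tproj_limit)
  ultimately show ?thesis
    unfolding closed_tensor_span_def closure_sequential
    by (intro exI[of _ "\<lambda>n. tproj n a - t (slice a) 1"] conjI allI)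
qed

lemma decomposition:
  "L = {y + z | y z. y \<in> closed_tensor_span t ideal_part trace_kernel \<and> z \<in> (\<lambda>m. t m 1) ` lie_part}"
  (is "L = ?R")
proof
  show "L \<subseteq> ?R"
  proof
    fix a assume a: "a \<in> L"
    show "a \<in> ?R"
      by (rule CollectI, intro exI[of _ "a - t (slice a) 1"] exI[of _ "t (slice a) 1"] conjI imageI)
        (simp_all add: minus_slice_in slice_in_lie_part a)
  qed
  show "?R \<subseteq> L"
    using closed_tensor_span_subset complex_vector.subspace_add[OF subspace_L]
    by (auto simp: lie_part_def)
qed

end

theorem corollary5p3:
  fixes t :: "'b::unital_complex_banach_algebra \<Rightarrow> 'f::unital_cstar_algebra \<Rightarrow> 'a::complex_banach_algebra"
    and L :: "'a set"
  assumes "uhf_algebra TYPE('f)"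
    and "projective_tensor_product t"
    and "closed_lie_ideal L"
  shows "\<exists>(I :: 'b set) (M :: 'b set). closed_ideal I \<and> closed_lie_ideal M \<and>
    L = {y + z | y z. y \<in> closed_tensor_span t I trace_kernel \<and> z \<in> (\<lambda>m. t m 1) ` M}"
proof -
  obtain S :: "nat \<Rightarrow> 'f set" and k e where "uhf_system S k e"
    using uhf_system_exists[OF assms(1)] by blast
  then interpret uhf_tensor_lie S k e t L
    using assms(2,3)
    by (intro uhf_tensor_lie.intro uhf_tensor.intro uhf_tensor_lie_axioms.intro)
  show ?thesis
    by (intro exI conjI) (rule closed_ideal_ideal_part closed_lie_ideal_lie_part decomposition)+
qed

end
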